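(* The semigroup free product of two (von Neumann) regular word-hyperbolic semigroups is word-hyperbolic.
   Context: A semigroup $S$ is (von Neumann) regular if for every $s\in S$ there is $t\in S$ with $sts=s$. For a word $w=a_1\cdots a_n$ write $w^{\mathrm{rev}}=a_n\cdots a_1$. Let $S$ be a semigroup generated by a finite set $A$, with surjective homomorphism $\pi_S\colon A^+\to S$; $u=_Sv$ means $\pi_S(u)=\pi_S(v)$. A regular combing of $S$ is a regular language $R\subseteq A^+$ with $\pi_S(R)=S$. With $\#_1,\#_2$ new symbols not in $A$, let $\mathcal{T}_S(R)=\{u\#_1v\#_2w^{\mathrm{rev}}\mid u,v,w\in R,\ u\cdot v=_Sw\}$. $S$ is word-hyperbolic if $\mathcal{T}_S(R)$ is context-free for some finite generating set $A$ and some regular combing $R$. The semigroup free product of $S_1=\mathrm{Sgp}\langle A_1\mid\mathscr{R}_1\rangle$ and $S_2=\mathrm{Sgp}\langle A_2\mid\mathscr{R}_2\rangle$ with $A_1\cap A_2=\varnothing$ is $\mathrm{Sgp}\langle A_1\cup A_2\mid\mathscr{R}_1\cup\mathscr{R}_2\rangle$, i.e. the coproduct in the category of semigroups. *)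

theory Defs
  imports Main "HOL-Algebra.Congruence"
begin

section \<open>Semigroups\<close>

text \<open>The library has no carrier-based semigroups, only monoids, so the multiplication is
  added to \<^type>\<open>partial_object_ext\<close> here.  The carrier may be empty, in accordance with
  a presentation that has no generators.\<close>

record 'a sgp = "'a partial_object" +
  smult :: "'a \<Rightarrow> 'a \<Rightarrow> 'a" (infixl "\<odot>\<index>" 70)

locale is_sgp =
  fixes S :: "'a sgp" (structure)
  assumes smult_closed: "\<lbrakk>x \<in> carrier S; y \<in> carrier S\<rbrakk> \<Longrightarrow> x \<odot> y \<in> carrier S"
    and smult_assoc: "\<lbrakk>x \<in> carrier S; y \<in> carrier S; z \<in> carrier S\<rbrakk>
      \<Longrightarrow> (x \<odot> y) \<odot> z = x \<odot> (y \<odot> z)"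

definition sgp_regular :: "'a sgp \<Rightarrow> bool" where
  "sgp_regular S \<longleftrightarrow>
     (\<forall>s\<in>carrier S. \<exists>t\<in>carrier S. (s \<odot>\<^bsub>S\<^esub> t) \<odot>\<^bsub>S\<^esub> s = s)"

definition sgp_iso :: "'a sgp \<Rightarrow> 'b sgp \<Rightarrow> bool" where
  "sgp_iso S T \<longleftrightarrow> (\<exists>f. bij_betw f (carrier S) (carrier T) \<and>
     (\<forall>x\<in>carrier S. \<forall>y\<in>carrier S. f (x \<odot>\<^bsub>S\<^esub> y) = f x \<odot>\<^bsub>T\<^esub> f y))"

section \<open>Words and semigroup presentations\<close>

definition nonempty_words :: "'x set \<Rightarrow> 'x list set" where
  "nonempty_words A = lists A - {[]}"

definition sgp_relations :: "'x set \<Rightarrow> ('x list \<times> 'x list) set \<Rightarrow> bool" where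
  "sgp_relations A R \<longleftrightarrow> R \<subseteq> nonempty_words A \<times> nonempty_words A"

inductive_set generated_cong :: "'x set \<Rightarrow> ('x list \<times> 'x list) set \<Rightarrow> ('x list \<times> 'x list) set"
  for A :: "'x set" and R :: "('x list \<times> 'x list) set" where
  base: "(u, v) \<in> R \<Longrightarrow> (u, v) \<in> generated_cong A R"
| refl: "u \<in> nonempty_words A \<Longrightarrow> (u, u) \<in> generated_cong A R"
| sym: "(u, v) \<in> generated_cong A R \<Longrightarrow> (v, u) \<in> generated_cong A R"
| trans: "\<lbrakk>(u, v) \<in> generated_cong A R; (v, w) \<in> generated_cong A R\<rbrakk>
    \<Longrightarrow> (u, w) \<in> generated_cong A R"
| left: "\<lbrakk>(u, v) \<in> generated_cong A R; w \<in> nonempty_words A\<rbrakk>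
    \<Longrightarrow> (w @ u, w @ v) \<in> generated_cong A R"
| right: "\<lbrakk>(u, v) \<in> generated_cong A R; w \<in> nonempty_words A\<rbrakk>
    \<Longrightarrow> (u @ w, v @ w) \<in> generated_cong A R"

definition Sgp :: "'x set \<Rightarrow> ('x list \<times> 'x list) set \<Rightarrow> 'x list set sgp" where
  "Sgp A R = \<lparr>carrier = nonempty_words A // generated_cong A R,
     smult = (\<lambda>X Y. \<Union>u\<in>X. \<Union>v\<in>Y. generated_cong A R `` {u @ v})\<rparr>"

section \<open>Regular and context-free languages\<close>

text \<open>States and nonterminals are natural numbers; as only finitely many occur, this is no
  restriction.\<close>

definition regular_language :: "'x set \<Rightarrow> 'x list set \<Rightarrow> bool" where
  "regular_language A L \<longleftrightarrow>
     (\<exists>(Q::nat set) q0 (\<delta> :: nat \<Rightarrow> 'x \<Rightarrow> nat) F.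
        finite Q \<and> q0 \<in> Q \<and> F \<subseteq> Q \<and> (\<forall>q\<in>Q. \<forall>a\<in>A. \<delta> q a \<in> Q) \<and>
        L = {w \<in> lists A. foldl \<delta> q0 w \<in> F})"

text \<open>In a sentential form, \<open>Inl\<close> marks nonterminals and \<open>Inr\<close> marks terminals.\<close>

definition cfg_step :: "('n \<times> ('n + 't) list) set \<Rightarrow> (('n + 't) list \<times> ('n + 't) list) set" where
  "cfg_step P = {(u @ [Inl N] @ v, u @ w @ v) | u N w v. (N, w) \<in> P}"

definition cfg_language :: "('n \<times> ('n + 't) list) set \<Rightarrow> 'n \<Rightarrow> 't list set" where
  "cfg_language P N0 = {w. ([Inl N0], map Inr w) \<in> (cfg_step P)\<^sup>*}"

definition context_free :: "'t list set \<Rightarrow> bool" where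
  "context_free L \<longleftrightarrow>
     (\<exists>(P :: (nat \<times> (nat + 't) list) set) N0. finite P \<and> L = cfg_language P N0)"

section \<open>Word-hyperbolic semigroups\<close>

text \<open>The homomorphism from the nonempty words over the carrier that extends the identity on
  letters.  The value on the empty word is never used.\<close>

fun word_value :: "'a sgp \<Rightarrow> 'a list \<Rightarrow> 'a" where
  "word_value S [] = undefined"
| "word_value S [a] = a"
| "word_value S (a # b # w) = a \<odot>\<^bsub>S\<^esub> word_value S (b # w)"

definition generates :: "'a set \<Rightarrow> 'a sgp \<Rightarrow> bool" where
  "generates A S \<longleftrightarrow> A \<subseteq> carrier S \<and> word_value S ` nonempty_words A = carrier S"

definition regular_combing :: "'a sgp \<Rightarrow> 'a set \<Rightarrow> 'a list set \<Rightarrow> bool" where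
  "regular_combing S A R \<longleftrightarrow>
     regular_language A R \<and> R \<subseteq> nonempty_words A \<and> word_value S ` R = carrier S"

datatype 'a marked = Letter 'a | Hash1 | Hash2

definition mult_table :: "'a sgp \<Rightarrow> 'a list set \<Rightarrow> 'a marked list set" where
  "mult_table S R =
     {map Letter u @ [Hash1] @ map Letter v @ [Hash2] @ map Letter (rev w) | u v w.
        u \<in> R \<and> v \<in> R \<and> w \<in> R \<and> word_value S (u @ v) = word_value S w}"

definition word_hyperbolic :: "'a sgp \<Rightarrow> bool" where
  "word_hyperbolic S \<longleftrightarrow>
     (\<exists>A R. finite A \<and> generates A S \<and> regular_combing S A R \<and> context_free (mult_table S R))"

section \<open>Free products\<close>

text \<open>\<open>P\<close> is the semigroup free product of \<open>S1\<close> and \<open>S2\<close>, taken with respect to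
  presentations of the factors over disjoint alphabets.  No finiteness of the presentations is
  required.\<close>

definition is_free_product ::
  "'x set \<Rightarrow> ('x list \<times> 'x list) set \<Rightarrow> 'a sgp \<Rightarrow>
   'x set \<Rightarrow> ('x list \<times> 'x list) set \<Rightarrow> 'b sgp \<Rightarrow> 'c sgp \<Rightarrow> bool" where
  "is_free_product A1 R1 S1 A2 R2 S2 P \<longleftrightarrow>
     A1 \<inter> A2 = {} \<and> sgp_relations A1 R1 \<and> sgp_relations A2 R2 \<and>
     sgp_iso S1 (Sgp A1 R1) \<and> sgp_iso S2 (Sgp A2 R2) \<and>
     sgp_iso P (Sgp (A1 \<union> A2) (R1 \<union> R2))"

end

theory Submission
  imports Defs
begin

text \<open>Every element of a semigroup free product is uniquely an alternating product of elements of
  the factors, so alternating products of words of the given combings form a regular combing.  In the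
  product of two such elements at most one pair of neighbouring syllables is multiplied, and all other
  syllables are copied.  The multiplication table is therefore generated by nesting words
  \<open>u #\<^sub>2 w\<^sup>r\<^sup>e\<^sup>v\<close> with \<open>u = w\<close> in a factor around one word of the table of a factor (or around none),
  which is a context-free process once the language of these pairs \<open>u = w\<close> is context-free.  Regularity
  provides that: if \<open>a \<odot> t \<odot> a = a\<close> then \<open>a \<odot> t\<close> fixes every word that starts with the generator \<open>a\<close>,
  so equality is left multiplication by one of finitely many elements.\<close>

section \<open>Context-free grammars\<close>

text \<open>A combing may contain many words for one element, so a syllable that is merely copied
  from \<open>u\<close> or \<open>v\<close> can be spelt differently in \<open>w\<close>. Hence
  equality has to be recognised as well as multiplication, and a semigroup need not have an identity
  that would make equality a special case of its multiplication table. In a semigroup free product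
  no syllable is ever erased, not even an identity of a factor; a merged pair is again one syllable,
  so merging does not cascade. This is why one table word in the centre of the nesting is enough.
  The nesting has infinitely many productions, one for each word of a table, so it is not a grammar
  in the usual sense; \<open>context_free_nested\<close> allows the bodies to range over
  context-free languages. Uniqueness of normal forms in the presented semigroup comes from letting
  words act on sequences by \<open>push\<close>: both sides of a defining relation have the same
  normal form, so no confluence argument is needed.\<close>

inductive derives :: "('n \<times> ('n + 't) list) set \<Rightarrow> ('n + 't) list \<Rightarrow> 't list \<Rightarrow> bool"
  for P :: "('n \<times> ('n + 't) list) set" where
  derives_Nil: "derives P [] []"
| derives_Inr: "derives P \<alpha> w \<Longrightarrow> derives P (Inr a # \<alpha>) (a # w)"
| derives_Inl: "\<lbrakk>(N, \<beta>) \<in> P; derives P \<beta> u; derives P \<alpha> w\<rbrakk> \<Longrightarrow> derives P (Inl N # \<alpha>) (u @ w)"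

inductive_cases derives_NilE [elim!]: "derives P [] w"
inductive_cases derives_InrE [elim!]: "derives P (Inr a # \<alpha>) w"
inductive_cases derives_InlE: "derives P (Inl N # \<alpha>) w"

lemma derives_appendI: "derives P \<alpha> u \<Longrightarrow> derives P \<beta> v \<Longrightarrow> derives P (\<alpha> @ \<beta>) (u @ v)"
proof (induction rule: derives.induct)
  case (derives_Inl N \<beta>' u \<alpha> w)
  then show ?case using derives.derives_Inl[of N \<beta>' P u "\<alpha> @ \<beta>" "w @ v"] by simp
qed (auto intro: derives.intros)

lemma derives_appendE:
  assumes "derives P (\<alpha> @ \<beta>) w"
  obtains u v where "w = u @ v" "derives P \<alpha> u" "derives P \<beta> v"
  using assms
proof (induction \<alpha> arbitrary: w thesis)
  case Nil
  then show ?case using derives_Nil by (metis append_Nil)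
next
  case (Cons x \<alpha>)
  show ?case
  proof (cases x)
    case (Inl N)
    with Cons.prems(2) have "derives P (Inl N # (\<alpha> @ \<beta>)) w" by simp
    then obtain \<gamma> u v where "(N, \<gamma>) \<in> P" "derives P \<gamma> u" "derives P (\<alpha> @ \<beta>) v" "w = u @ v"
      by (auto elim: derives_InlE)
    then show ?thesis using Cons.IH[of v] Cons.prems(1) Inl derives_Inl by (metis append.assoc)
  next
    case (Inr a)
    with Cons.prems(2) obtain v where "derives P (\<alpha> @ \<beta>) v" "w = a # v" by auto
    then show ?thesis using Cons.IH[of v] Cons.prems(1) Inr derives_Inr by (metis append_Cons)
  qed
qed

lemma derives_terminals_iff: "derives P (map Inr w) v \<longleftrightarrow> v = w"
proof
  show "derives P (map Inr w) v \<Longrightarrow> v = w"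
    by (induction w arbitrary: v) auto
  show "v = w \<Longrightarrow> derives P (map Inr w) v"
    by (induction w arbitrary: v) (auto intro: derives.intros)
qed

lemma derives_single_iff: "derives P [Inl N] w \<longleftrightarrow> (\<exists>\<beta>. (N, \<beta>) \<in> P \<and> derives P \<beta> w)"
proof
  show "derives P [Inl N] w \<Longrightarrow> \<exists>\<beta>. (N, \<beta>) \<in> P \<and> derives P \<beta> w"
    by (auto elim!: derives_InlE)
  show "\<exists>\<beta>. (N, \<beta>) \<in> P \<and> derives P \<beta> w \<Longrightarrow> derives P [Inl N] w"
    using derives_Inl[of N _ P w "[]" "[]"] derives_Nil by auto
qed

lemma derives_surround:
  "derives P [Inl N] w \<Longrightarrow> derives P (map Inr x @ Inl N # map Inr y) (x @ w @ y)"
  using derives_appendI[OF _ derives_appendI, of P "map Inr x" x "[Inl N]" w "map Inr y" y]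
  by (simp add: derives_terminals_iff)

lemma cfg_steps_context:
  assumes "(\<alpha>, \<beta>) \<in> (cfg_step P)\<^sup>*"
  shows "(\<gamma> @ \<alpha> @ \<delta>, \<gamma> @ \<beta> @ \<delta>) \<in> (cfg_step P)\<^sup>*"
  using assms
proof induction
  case (step \<beta> \<beta>')
  from step.hyps(2) obtain u N w v where "\<beta> = u @ [Inl N] @ v" "\<beta>' = u @ w @ v" "(N, w) \<in> P"
    by (auto simp: cfg_step_def)
  moreover have "((\<gamma> @ u) @ [Inl N] @ (v @ \<delta>), (\<gamma> @ u) @ w @ (v @ \<delta>)) \<in> cfg_step P"
    using \<open>(N, w) \<in> P\<close> unfolding cfg_step_def by blast
  ultimately have "(\<gamma> @ \<beta> @ \<delta>, \<gamma> @ \<beta>' @ \<delta>) \<in> cfg_step P" by simp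
  with step.IH show ?case by (rule rtrancl_into_rtrancl)
qed simp

lemma derives_imp_cfg_steps: "derives P \<alpha> w \<Longrightarrow> (\<alpha>, map Inr w) \<in> (cfg_step P)\<^sup>*"
proof (induction rule: derives.induct)
  case (derives_Inr \<alpha> w a)
  then show ?case using cfg_steps_context[of \<alpha> "map Inr w" P "[Inr a]" "[]"] by simp
next
  case (derives_Inl N \<beta> u \<alpha> w)
  have "([] @ [Inl N] @ \<alpha>, [] @ \<beta> @ \<alpha>) \<in> cfg_step P"
    using derives_Inl.hyps(1) unfolding cfg_step_def by blast
  moreover have "(\<beta> @ \<alpha>, map Inr u @ \<alpha>) \<in> (cfg_step P)\<^sup>*"
    using cfg_steps_context[OF derives_Inl.IH(1), of "[]" \<alpha>] by simp
  moreover have "(map Inr u @ \<alpha>, map Inr u @ map Inr w) \<in> (cfg_step P)\<^sup>*"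
    using cfg_steps_context[OF derives_Inl.IH(2), of "map Inr u" "[]"] by simp
  ultimately show ?case by (simp add: converse_rtrancl_into_rtrancl rtrancl_trans)
qed simp

text \<open>Peeling rewriting steps off the front keeps the terminal word fixed: the factor derived
  from the new body becomes the factor derived from the nonterminal that the body replaced.\<close>

lemma cfg_steps_imp_derives:
  assumes "(\<alpha>, map Inr w) \<in> (cfg_step P)\<^sup>*"
  shows "derives P \<alpha> w"
  using assms
proof (induction rule: converse_rtrancl_induct)
  case base
  show ?case by (simp add: derives_terminals_iff)
next
  case (step \<alpha> \<alpha>')
  then obtain u N \<beta> v where \<alpha>: "\<alpha> = u @ [Inl N] @ v" "\<alpha>' = u @ \<beta> @ v" "(N, \<beta>) \<in> P"
    by (auto simp: cfg_step_def)
  with step.IH obtain w1 w2 w3 where w: "w = w1 @ w2 @ w3"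
    and "derives P u w1" "derives P \<beta> w2" "derives P v w3"
    by (metis derives_appendE)
  then have "derives P [Inl N] w2" using \<alpha>(3) by (auto simp: derives_single_iff)
  then show ?case unfolding \<alpha> w
    by (intro derives_appendI \<open>derives P u w1\<close> \<open>derives P v w3\<close>)
qed

text \<open>\<open>derives\<close> is the big-step counterpart of \<open>cfg_step\<close>: induction
  on it runs over whole parse trees. All later arguments use it, also for infinite production
  sets.\<close>

lemma cfg_language_derives: "cfg_language P N = {w. derives P [Inl N] w}"
  using derives_imp_cfg_steps cfg_steps_imp_derives unfolding cfg_language_def by blast

lemma context_free_iff_derives:
  "context_free L \<longleftrightarrow> (\<exists>(P :: (nat \<times> (nat + 't) list) set) N. finite P \<and> L = {w :: 't list. derives P [Inl N] w})"
  unfolding context_free_def cfg_language_derives ..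

text \<open>A renaming that identifies nonterminals may add derivations but loses none, so no
  injectivity is asked for; a converse is obtained by renaming back.\<close>

lemma derives_rename:
  "derives P \<alpha> w \<Longrightarrow> derives (map_prod f (map (map_sum f (\<lambda>x. x))) ` P) (map (map_sum f (\<lambda>x. x)) \<alpha>) w"
proof (induction rule: derives.induct)
  case (derives_Inl N \<beta> u \<alpha> w)
  have "(f N, map (map_sum f (\<lambda>x. x)) \<beta>) \<in> map_prod f (map (map_sum f (\<lambda>x. x))) ` P"
    using derives_Inl.hyps(1) by (rule rev_image_eqI) simp
  from derives.derives_Inl[OF this derives_Inl.IH] show ?case by simp
qed (auto intro: derives.intros)

text \<open>Frees later grammars from coding nonterminals as numbers: finitely many occur, an
  injection into \<open>nat\<close> codes them, and renaming along its left inverse shows that no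
  new word arises.\<close>

lemma context_freeI:
  fixes P :: "('n \<times> ('n + 't) list) set"
  assumes fin: "finite P" and L: "\<And>w. w \<in> L \<longleftrightarrow> derives P [Inl N] w"
  shows "context_free L"
proof -
  \<comment> \<open>Nonterminals seen only in right-hand sides belong to \<open>U\<close> too, since
    \<open>g\<close> must undo \<open>f\<close> on every symbol of a body.\<close>
  define U where "U = insert N (\<Union>(M, \<beta>)\<in>P. insert M {M'. Inl M' \<in> set \<beta>})"
  have "{M'. Inl M' \<in> set \<beta>} = Inl -` set \<beta>" for \<beta> :: "('n + 't) list" by auto
  then have "finite U" unfolding U_def
    using fin by (auto intro!: finite_vimageI)
  then obtain f :: "'n \<Rightarrow> nat" where "inj_on f U"
    using finite_imp_inj_to_nat_seg by blast
  define g where "g = inv_into U f"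
  have gf: "g (f M) = M" if "M \<in> U" for M
    using that \<open>inj_on f U\<close> by (simp add: g_def)
  let ?r = "\<lambda>h. map_prod h (map (map_sum h (\<lambda>x. x)))"
  have "?r g (?r f p) = p" if p: "p \<in> P" for p
  proof -
    obtain M \<beta> where [simp]: "p = (M, \<beta>)" by fastforce
    have "g (f M) = M" using p by (intro gf) (auto simp: U_def)
    moreover have "map_sum (g \<circ> f) (\<lambda>x. x) x = x" if "x \<in> set \<beta>" for x
      using p that by (cases x) (force intro!: gf simp: U_def)+
    then have "map (map_sum g (\<lambda>x. x) \<circ> map_sum f (\<lambda>x. x)) \<beta> = \<beta>"
      by (intro map_idI) (simp add: sum.map_comp comp_def)
    ultimately show ?thesis by simp
  qed
  then have gf_P: "?r g ` ?r f ` P = P"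
    by (simp add: image_image cong: image_cong)
  have "derives P [Inl N] w \<longleftrightarrow> derives (?r f ` P) [Inl (f N)] w" for w
  proof
    show "derives P [Inl N] w \<Longrightarrow> derives (?r f ` P) [Inl (f N)] w"
      using derives_rename[of P "[Inl N]" w f] by simp
    have "g (f N) = N" by (intro gf) (simp add: U_def)
    then show "derives (?r f ` P) [Inl (f N)] w \<Longrightarrow> derives P [Inl N] w"
      using derives_rename[of "?r f ` P" "[Inl (f N)]" w g] gf_P by simp
  qed
  then have "L = {w. derives (?r f ` P) [Inl (f N)] w}" using L by auto
  with fin show ?thesis unfolding context_free_iff_derives by blast
qed

section \<open>Closure properties of context-free languages\<close>

lemma context_free_finite:
  assumes "finite L"
  shows "context_free L"
proof (rule context_freeI)
  show "finite ((\<lambda>w. ((), map Inr w)) ` L)" using assms by simp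
  show "w \<in> L \<longleftrightarrow> derives ((\<lambda>w. ((), map Inr w)) ` L) [Inl ()] w" for w
    by (auto simp: derives_single_iff derives_terminals_iff)
qed

text \<open>\<open>f\<close> may identify letters, but it leaves nonterminals alone. A derivation in
  the image grammar therefore lifts along any given preimage of its sentential form, each production
  being lifted to one of its preimages.\<close>

lemma context_free_map:
  assumes "context_free L"
  shows "context_free (map f ` L)"
proof -
  obtain P :: "(nat \<times> (nat + 'a) list) set" and N where P: "finite P"
    and L: "L = {w. derives P [Inl N] w}"
    using assms unfolding context_free_iff_derives by blast
  let ?P = "map_prod (\<lambda>x. x) (map (map_sum (\<lambda>x. x) f)) ` P"
  have fwd: "derives P \<alpha> w \<Longrightarrow> derives ?P (map (map_sum (\<lambda>x. x) f) \<alpha>) (map f w)" for \<alpha> w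
  proof (induction rule: derives.induct)
    case (derives_Inl N \<beta> u \<alpha> w)
    have "(N, map (map_sum (\<lambda>x. x) f) \<beta>) \<in> ?P"
      using derives_Inl.hyps(1) by (rule rev_image_eqI) simp
    from derives.derives_Inl[OF this derives_Inl.IH] show ?case by simp
  qed (auto intro: derives.intros)
  have bwd: "derives ?P \<gamma> v \<Longrightarrow> \<gamma> = map (map_sum (\<lambda>x. x) f) \<alpha> \<Longrightarrow> \<exists>w. v = map f w \<and> derives P \<alpha> w"
    for \<gamma> v \<alpha>
  proof (induction arbitrary: \<alpha> rule: derives.induct)
    case derives_Nil
    then show ?case by (auto intro: derives.derives_Nil)
  next
    case (derives_Inr \<gamma> v b)
    then obtain x \<alpha>' where \<alpha>: "\<alpha> = x # \<alpha>'" "Inr b = map_sum (\<lambda>x. x) f x" "\<gamma> = map (map_sum (\<lambda>x. x) f) \<alpha>'"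
      by auto
    moreover obtain a where "x = Inr a" "b = f a" using \<alpha>(2) by (cases x) auto
    ultimately show ?case using derives_Inr.IH
      by (metis derives.derives_Inr list.simps(9))
  next
    case (derives_Inl M \<beta> u \<gamma> v)
    then obtain x \<alpha>' where \<alpha>: "\<alpha> = x # \<alpha>'" "Inl M = map_sum (\<lambda>x. x) f x" "\<gamma> = map (map_sum (\<lambda>x. x) f) \<alpha>'"
      by auto
    have x: "x = Inl M" using \<alpha>(2) by (cases x) auto
    obtain \<beta>' where \<beta>': "(M, \<beta>') \<in> P" "\<beta> = map (map_sum (\<lambda>x. x) f) \<beta>'"
      using derives_Inl.hyps(1) by auto
    obtain w1 w2 where "u = map f w1" "derives P \<beta>' w1" "v = map f w2" "derives P \<alpha>' w2"
      using derives_Inl.IH(1)[OF \<beta>'(2)] derives_Inl.IH(2)[OF \<alpha>(3)] by auto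
    then show ?case unfolding \<alpha>(1) x
      by (intro exI[of _ "w1 @ w2"]) (auto intro: derives.derives_Inl[OF \<beta>'(1)])
  qed
  show ?thesis
  proof (rule context_freeI)
    show "finite ?P" using P by simp
    show "w \<in> map f ` L \<longleftrightarrow> derives ?P [Inl N] w" for w
    proof
      assume "w \<in> map f ` L"
      then obtain v where "derives P [Inl N] v" "w = map f v" unfolding L by blast
      then show "derives ?P [Inl N] w" using fwd[of "[Inl N]" v] by simp
    next
      assume "derives ?P [Inl N] w"
      then have "\<exists>v. w = map f v \<and> derives P [Inl N] v" by (rule bwd) simp
      then show "w \<in> map f ` L" unfolding L by blast
    qed
  qed
qed

text \<open>\<open>Inl (N, True)\<close> generates the words \<open>w\<close> such that \<open>N\<close> generates \<open>a # w\<close>,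
  and \<open>(N, False)\<close> is a copy of \<open>N\<close>.  The letter \<open>a\<close> is read off the first symbol of
  a sentential form that does not vanish.\<close>

abbreviation copy_form :: "('n + 't) list \<Rightarrow> ('n \<times> bool + 't) list" where
  "copy_form \<equiv> map (map_sum (\<lambda>N. (N, False)) (\<lambda>x. x))"

fun deriv_forms ::
  "('n \<times> ('n + 't) list) set \<Rightarrow> 't \<Rightarrow> ('n + 't) list \<Rightarrow> ('n \<times> bool + 't) list set" where
  "deriv_forms P a [] = {}"
| "deriv_forms P a (Inr b # \<alpha>) = (if b = a then {copy_form \<alpha>} else {})"
| "deriv_forms P a (Inl N # \<alpha>) = insert (Inl (N, True) # copy_form \<alpha>)
     (if derives P [Inl N] [] then deriv_forms P a \<alpha> else {})"

lemma context_free_deriv: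
  assumes "context_free L"
  shows "context_free {w. a # w \<in> L}"
proof -
  obtain P :: "(nat \<times> (nat + 'a) list) set" and N where fin: "finite P"
    and L: "L = {w. derives P [Inl N] w}"
    using assms unfolding context_free_iff_derives by blast
  define D where "D = deriv_forms P a"
  define P' where "P' = (\<Union>(N, \<beta>)\<in>P. insert ((N, False), copy_form \<beta>) (Pair (N, True) ` D \<beta>))"
  have "finite (D \<alpha>)" for \<alpha>
    unfolding D_def by (induction P a \<alpha> rule: deriv_forms.induct) auto
  with fin have fin': "finite P'" unfolding P'_def by auto
  have copy: "derives P \<alpha> w \<Longrightarrow> derives P' (copy_form \<alpha>) w" for \<alpha> w
  proof (induction rule: derives.induct)
    case (derives_Inl N \<beta> u \<alpha> w)
    then have "((N, False), copy_form \<beta>) \<in> P'" by (auto simp: P'_def)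
    with derives_Inl.IH show ?case by (auto intro: derives.derives_Inl)
  qed (auto intro: derives.intros)
  have fwd: "derives P \<alpha> v \<Longrightarrow> v = a # w \<Longrightarrow> \<exists>\<delta>\<in>D \<alpha>. derives P' \<delta> w" for \<alpha> v w
  proof (induction arbitrary: w rule: derives.induct)
    case (derives_Inr \<alpha> w b)
    then show ?case by (auto simp: D_def copy)
  next
    case (derives_Inl N \<beta> u \<alpha> v)
    show ?case
    proof (cases u)
      case Nil
      then have "derives P [Inl N] []"
        using derives_Inl.hyps by (auto simp: derives_single_iff)
      then show ?thesis using derives_Inl.IH(2)[of w] derives_Inl.prems Nil by (auto simp: D_def)
    next
      case (Cons b u')
      then have u: "u = a # u'" and w: "w = u' @ v" using derives_Inl.prems by auto
      obtain \<delta> where "\<delta> \<in> D \<beta>" "derives P' \<delta> u'" using derives_Inl.IH(1)[OF u] by auto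
      moreover from this have "((N, True), \<delta>) \<in> P'" using derives_Inl.hyps(1) by (auto simp: P'_def)
      ultimately have "derives P' (Inl (N, True) # copy_form \<alpha>) w"
        unfolding w using copy[OF derives_Inl.hyps(3)] by (intro derives.derives_Inl)
      then show ?thesis by (auto simp: D_def)
    qed
  qed simp
  \<comment> \<open>Stated under hypotheses on \<open>\<delta>\<close> alone, so that it can be
    applied within the induction for \<open>bwd\<close>, where they are the induction hypothesis for
    the chosen body.\<close>
  have D_sound: "derives P \<beta> (a # w)"
    if "\<delta> \<in> D \<beta>" "\<And>\<alpha>. \<delta> = copy_form \<alpha> \<Longrightarrow> derives P \<alpha> w"
      "\<And>M \<alpha>. \<delta> = Inl (M, True) # copy_form \<alpha> \<Longrightarrow> derives P (Inl M # \<alpha>) (a # w)" for \<beta> \<delta> w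
    using that(1) unfolding D_def
  proof (induction \<beta>)
    case (Cons x \<beta>)
    show ?case
    proof (cases x)
      case (Inl M)
      show ?thesis
      proof (cases "\<delta> = Inl (M, True) # copy_form \<beta>")
        case True
        then show ?thesis using that(3) Inl by simp
      next
        case False
        then have "derives P [Inl M] []" "derives P \<beta> (a # w)"
          using Cons Inl by (auto split: if_splits)
        then show ?thesis using derives_appendI[of P "[Inl M]" "[]" \<beta> "a # w"] Inl by simp
      qed
    next
      case (Inr b)
      then show ?thesis using Cons.prems that(2)[of \<beta>] by (auto split: if_splits intro: derives_Inr)
    qed
  qed simp
  \<comment> \<open>Both shapes go into one induction: behind a marked nonterminal stand only
    copies, and the body chosen for the marked one may have either shape.\<close>
  have bwd: "derives P' \<delta> w \<Longrightarrow> (\<forall>\<alpha>. \<delta> = copy_form \<alpha> \<longrightarrow> derives P \<alpha> w) \<and>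
     (\<forall>M \<alpha>. \<delta> = Inl (M, True) # copy_form \<alpha> \<longrightarrow> derives P (Inl M # \<alpha>) (a # w))" for \<delta> w
  proof (induction rule: derives.induct)
    case derives_Nil
    then show ?case by (auto intro: derives.derives_Nil)
  next
    case (derives_Inr \<gamma> v b)
    have "derives P \<alpha> (b # v)" if eq: "Inr b # \<gamma> = copy_form \<alpha>" for \<alpha>
    proof -
      obtain x \<alpha>' where \<alpha>: "\<alpha> = x # \<alpha>'" "map_sum (\<lambda>N. (N, False)) (\<lambda>x. x) x = Inr b" "\<gamma> = copy_form \<alpha>'"
        using eq by auto
      moreover have "x = Inr b" using \<alpha>(2) by (cases x) auto
      ultimately show ?thesis using derives_Inr.IH by (auto intro: derives.derives_Inr)
    qed
    then show ?case by simp
  next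
    case (derives_Inl K \<beta> u \<gamma> v)
    have "derives P \<alpha> (u @ v)" if eq: "Inl K # \<gamma> = copy_form \<alpha>" for \<alpha>
    proof -
      obtain x \<alpha>' where \<alpha>: "\<alpha> = x # \<alpha>'" "map_sum (\<lambda>N. (N, False)) (\<lambda>x. x) x = Inl K" "\<gamma> = copy_form \<alpha>'"
        using eq by auto
      moreover obtain M where M: "x = Inl M" "K = (M, False)" using \<alpha>(2) by (cases x) auto
      moreover obtain \<beta>' where "(M, \<beta>') \<in> P" "\<beta> = copy_form \<beta>'"
        using derives_Inl.hyps(1) M(2) by (auto simp: P'_def)
      ultimately show ?thesis using derives_Inl.IH by (auto intro: derives.derives_Inl)
    qed
    moreover have "derives P (Inl M # \<alpha>) (a # u @ v)"
      if eq: "K = (M, True)" "\<gamma> = copy_form \<alpha>" for M \<alpha>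
    proof -
      obtain \<beta>' where \<beta>': "(M, \<beta>') \<in> P" "\<beta> \<in> D \<beta>'"
        using derives_Inl.hyps(1) eq(1) by (auto simp: P'_def)
      have "derives P \<beta>' (a # u)"
        using D_sound[OF \<beta>'(2)] derives_Inl.IH(1) by blast
      then show ?thesis
        using derives.derives_Inl[OF \<beta>'(1), of "a # u" \<alpha> v] derives_Inl.IH(2) eq(2) by simp
    qed
    ultimately show ?case by simp
  qed
  show ?thesis
  proof (rule context_freeI[OF fin'])
    show "w \<in> {w. a # w \<in> L} \<longleftrightarrow> derives P' [Inl (N, True)] w" for w
    proof
      assume "w \<in> {w. a # w \<in> L}"
      then have "derives P [Inl N] (a # w)" by (simp add: L)
      then show "derives P' [Inl (N, True)] w"
        using fwd[of "[Inl N]" "a # w" w] by (auto simp: D_def split: if_splits)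
    next
      assume "derives P' [Inl (N, True)] w"
      then show "w \<in> {w. a # w \<in> L}"
        using bwd[of "[Inl (N, True)]" w] by (auto simp: L)
    qed
  qed
qed

lemma context_free_left_quotient: "context_free L \<Longrightarrow> context_free {w. x @ w \<in> L}"
proof (induction x arbitrary: L)
  case (Cons a x)
  from Cons.IH[OF context_free_deriv[OF Cons.prems, of a]] show ?case by simp
qed simp

text \<open>Closure under nested substitution. The grammar \<open>G v\<close> of the bodies of
  \<open>v\<close> is run inside \<open>H\<close> with its nonterminals tagged by \<open>v\<close>,
  and a letter \<open>Inl v\<close> of a body becomes the start symbol \<open>(v, s v)\<close> of
  the grammar for the next layer.\<close>

lemma context_free_nested:
  fixes L :: "'v \<Rightarrow> ('v + 't) list set"
  assumes V: "finite V" and L: "\<And>v. v \<in> V \<Longrightarrow> context_free (L v)"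
  shows "context_free {w. derives (Sigma V L) [Inl v0] w}"
proof -
  let ?B = "Sigma V L"
  have "\<forall>v\<in>V. \<exists>(G :: (nat \<times> (nat + ('v + 't)) list) set) s. finite G \<and> L v = {w. derives G [Inl s] w}"
    using L unfolding context_free_iff_derives by blast
  then obtain G :: "'v \<Rightarrow> (nat \<times> (nat + ('v + 't)) list) set" and s
    where G: "\<And>v. v \<in> V \<Longrightarrow> finite (G v)" "\<And>v. v \<in> V \<Longrightarrow> L v = {w. derives (G v) [Inl (s v)] w}"
    by metis
  define k :: "'v + 't \<Rightarrow> ('v \<times> nat) + 't" where "k = case_sum (\<lambda>v. Inl (v, s v)) Inr"
  define h where "h v = case_sum (\<lambda>N. Inl (v, N)) k" for v
  define H where "H = (\<Union>v\<in>V. (\<lambda>(N, \<alpha>). ((v, N), map (h v) \<alpha>)) ` G v)"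
  have "finite H" unfolding H_def using V G(1) by auto
  \<comment> \<open>A derivation of the body \<open>\<beta>\<close> in \<open>G v\<close> is
    continued by a derivation in \<open>H\<close> that starts from this body.\<close>
  have expand: "derives (G v) \<gamma> \<beta> \<Longrightarrow> derives H (map k \<beta>) u \<Longrightarrow> derives H (map (h v) \<gamma>) u"
    if v: "v \<in> V" for v \<gamma> \<beta> u
  proof (induction arbitrary: u rule: derives.induct)
    case (derives_Inr \<alpha> w a)
    then have "derives H ([k a] @ map k w) u" by simp
    then obtain u1 u2 where "u = u1 @ u2" "derives H [k a] u1" "derives H (map k w) u2"
      by (rule derives_appendE)
    then show ?case using derives_appendI[of H "[k a]" u1 "map (h v) \<alpha>" u2] derives_Inr.IH[of u2]
      by (simp add: h_def)
  next
    case (derives_Inl N \<beta> w1 \<alpha> w2)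
    then have "derives H (map k w1 @ map k w2) u" by simp
    then obtain u1 u2 where "u = u1 @ u2" "derives H (map k w1) u1" "derives H (map k w2) u2"
      by (rule derives_appendE)
    moreover have "((v, N), map (h v) \<beta>) \<in> H" using derives_Inl.hyps(1) v by (force simp: H_def)
    ultimately show ?case using derives_Inl.IH
      by (auto simp: h_def intro: derives.derives_Inl)
  qed simp
  have fwd: "derives ?B \<alpha> w \<Longrightarrow> derives H (map k \<alpha>) w" for \<alpha> w
  proof (induction rule: derives.induct)
    case (derives_Inl v \<beta> u \<alpha> w)
    then have "derives H (map (h v) [Inl (s v)]) u" using expand[of v "[Inl (s v)]" \<beta> u] G(2) by auto
    then show ?case
      using derives_appendI[of H "[Inl (v, s v)]" u "map k \<alpha>" w] derives_Inl.IH(2)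
      by (simp add: h_def k_def)
  qed (auto simp: k_def intro: derives.intros)
  have bwd: "derives H \<delta> w \<Longrightarrow> \<delta> = map (h v) \<gamma> \<Longrightarrow> \<exists>\<beta>. derives (G v) \<gamma> \<beta> \<and> derives ?B \<beta> w"
    for \<delta> w v \<gamma>
  proof (induction arbitrary: v \<gamma> rule: derives.induct)
    case derives_Nil
    then show ?case by (auto intro: derives.derives_Nil)
  next
    case (derives_Inr \<delta> w b)
    then obtain x \<gamma>' where \<gamma>: "\<gamma> = x # \<gamma>'" "h v x = Inr b" "\<delta> = map (h v) \<gamma>'" by auto
    then have x: "x = Inr (Inr b)" by (auto simp: h_def k_def split: sum.splits)
    obtain \<beta> where "derives (G v) \<gamma>' \<beta>" "derives ?B \<beta> w" using derives_Inr.IH[OF \<gamma>(3)] by auto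
    then show ?case unfolding \<gamma>(1) x
      by (intro exI[of _ "Inr b # \<beta>"]) (auto intro: derives.derives_Inr)
  next
    case (derives_Inl K \<alpha> u \<delta> w)
    then obtain x \<gamma>' where \<gamma>: "\<gamma> = x # \<gamma>'" "h v x = Inl K" "\<delta> = map (h v) \<gamma>'" by auto
    obtain v' N \<alpha>' where K: "K = (v', N)" "v' \<in> V" "(N, \<alpha>') \<in> G v'" "\<alpha> = map (h v') \<alpha>'"
      using derives_Inl.hyps(1) by (auto simp: H_def)
    obtain \<beta>1 where \<beta>1: "derives (G v') \<alpha>' \<beta>1" "derives ?B \<beta>1 u"
      using derives_Inl.IH(1)[OF K(4)] by auto
    obtain \<beta>2 where \<beta>2: "derives (G v) \<gamma>' \<beta>2" "derives ?B \<beta>2 w"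
      using derives_Inl.IH(2)[OF \<gamma>(3)] by auto
    \<comment> \<open>A nonterminal of \<open>H\<close> stems either from a nonterminal of the
      grammar \<open>G v\<close> being run, or from a letter of a body, where a fresh run of
      \<open>G v'\<close> starts.\<close>
    consider "x = Inl N" "v = v'" | "x = Inr (Inl v')" "N = s v'"
      using \<gamma>(2) K(1) unfolding h_def k_def by (auto split: sum.splits)
    then show ?case
    proof cases
      case 1
      then show ?thesis using \<gamma>(1) \<beta>1 \<beta>2 K(3)
        by (intro exI[of _ "\<beta>1 @ \<beta>2"]) (auto intro: derives.derives_Inl derives_appendI)
    next
      case 2
      have "(v', \<beta>1) \<in> ?B" using G(2) K(2,3) \<beta>1(1) 2(2) by (auto simp: derives_single_iff)
      with 2(1) \<gamma>(1) \<beta>1 \<beta>2 show ?thesis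
        by (intro exI[of _ "Inl v' # \<beta>2"]) (auto intro: derives.derives_Inl derives.derives_Inr)
    qed
  qed
  show ?thesis
  proof (rule context_freeI[OF \<open>finite H\<close>])
    fix w
    show "w \<in> {w. derives ?B [Inl v0] w} \<longleftrightarrow> derives H [Inl (v0, s v0)] w"
    proof
      assume "w \<in> {w. derives ?B [Inl v0] w}"
      then show "derives H [Inl (v0, s v0)] w" using fwd[of "[Inl v0]" w] by (simp add: k_def)
    next
      assume A: "derives H [Inl (v0, s v0)] w"
      then have "v0 \<in> V" by (auto simp: derives_single_iff H_def)
      moreover have "\<exists>\<beta>. derives (G v0) [Inl (s v0)] \<beta> \<and> derives ?B \<beta> w"
        using A by (rule bwd) (simp add: h_def)
      ultimately show "w \<in> {w. derives ?B [Inl v0] w}" using G(2) by (auto simp: derives_single_iff)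
    qed
  qed
qed

fun expand_form :: "('n \<Rightarrow> 't list set) \<Rightarrow> ('n + 't) list \<Rightarrow> 't list set" where
  "expand_form I [] = {[]}"
| "expand_form I (Inr a # \<alpha>) = Cons a ` expand_form I \<alpha>"
| "expand_form I (Inl N # \<alpha>) = {u @ v | u v. u \<in> I N \<and> v \<in> expand_form I \<alpha>}"

lemma expand_form_surround:
  "expand_form I (map Inr x @ Inl N # map Inr y) = {x @ w @ y | w. w \<in> I N}"
proof -
  have "expand_form I (map Inr y) = {y}" by (induction y) auto
  then show ?thesis by (induction x) auto
qed

text \<open>A grammar generates the least family of languages closed under its productions, so every
  closed family \<open>I\<close> is an upper bound.\<close>

lemma derives_sound:
  assumes "\<And>N \<beta>. (N, \<beta>) \<in> P \<Longrightarrow> expand_form I \<beta> \<subseteq> I N"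
  shows "derives P \<alpha> w \<Longrightarrow> w \<in> expand_form I \<alpha>"
  by (induction rule: derives.induct) (use assms in fastforce)+

section \<open>Multiplication and equality tables\<close>

lemma nonempty_words_Cons [simp]: "a # w \<in> nonempty_words A \<longleftrightarrow> a \<in> A \<and> w \<in> lists A"
  by (auto simp: nonempty_words_def)

lemma nonempty_words_append:
  "u \<in> nonempty_words A \<Longrightarrow> v \<in> nonempty_words A \<Longrightarrow> u @ v \<in> nonempty_words A"
  by (auto simp: nonempty_words_def)

lemma word_value_Cons: "w \<noteq> [] \<Longrightarrow> word_value S (a # w) = a \<odot>\<^bsub>S\<^esub> word_value S w"
  by (cases w) auto

context is_sgp
begin

lemma word_value_closed:
  "w \<in> nonempty_words (carrier S) \<Longrightarrow> word_value S w \<in> carrier S"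
proof (induction w)
  case (Cons a w)
  then show ?case
    by (cases "w = []") (auto simp: word_value_Cons nonempty_words_def intro: smult_closed)
qed (simp add: nonempty_words_def)

lemma word_value_append:
  "u \<in> nonempty_words (carrier S) \<Longrightarrow> v \<in> nonempty_words (carrier S) \<Longrightarrow>
    word_value S (u @ v) = word_value S u \<odot> word_value S v"
proof (induction u)
  case (Cons a u)
  then have v: "v \<noteq> []" by (simp add: nonempty_words_def)
  show ?case
  proof (cases "u = []")
    case True
    then show ?thesis using v by (simp add: word_value_Cons)
  next
    case False
    then have u: "u \<in> nonempty_words (carrier S)"
      using Cons.prems by (auto simp: nonempty_words_def)
    then show ?thesis
      using Cons False v word_value_closed[OF u] word_value_closed[of v]
      by (auto simp: word_value_Cons smult_assoc)
  qed
qed (simp add: nonempty_words_def)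

end

abbreviation eq_word :: "'a list \<Rightarrow> 'a list \<Rightarrow> 'a marked list" where
  "eq_word u w \<equiv> map Letter u @ [Hash2] @ map Letter (rev w)"

abbreviation mult_word :: "'a list \<Rightarrow> 'a list \<Rightarrow> 'a list \<Rightarrow> 'a marked list" where
  "mult_word u v w \<equiv> map Letter u @ [Hash1] @ map Letter v @ [Hash2] @ map Letter (rev w)"

definition equality_table :: "'a sgp \<Rightarrow> 'a list set \<Rightarrow> 'a marked list set" where
  "equality_table S R = {eq_word u w | u w. u \<in> R \<and> w \<in> R \<and> word_value S u = word_value S w}"

lemma Hash1_split:
  "map Letter u @ Hash1 # x = map Letter v @ Hash1 # y \<longleftrightarrow> u = v \<and> x = y"
proof (induction u arbitrary: v)
  case Nil
  then show ?case by (cases v) auto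
next
  case (Cons a u)
  then show ?case by (cases v) auto
qed

text \<open>The element that acts as a left identity depends only on the first letter
  \<open>a\<close>. Cutting the prefix \<open>e a\<close>, \<open>Hash1\<close>, \<open>a\<close>
  off the words of the multiplication table leaves the pairs whose first word starts with
  \<open>a\<close>, without that letter. Putting \<open>a\<close> back in front and taking the union
  over the finite alphabet gives the equality table.\<close>

lemma context_free_equality_table:
  assumes "is_sgp S" "sgp_regular S" and fin: "finite A" and "generates A S"
    and comb: "regular_combing S A R" and cf: "context_free (mult_table S R)"
  shows "context_free (equality_table S R)"
proof -
  interpret is_sgp S by fact
  have A: "A \<subseteq> carrier S" using assms(4) by (simp add: generates_def)
  have R: "R \<subseteq> nonempty_words A" "word_value S ` R = carrier S"
    using comb by (auto simp: regular_combing_def)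
  have RC: "R \<subseteq> nonempty_words (carrier S)"
    using R(1) A by (auto simp: nonempty_words_def)
  \<comment> \<open>\<open>e\<close> is a word for \<open>a \<odot> t\<close> with \<open>t\<close>
    given by regularity. It is taken from \<open>R\<close> because the multiplication table lists
    only words of the combing.\<close>
  have "\<exists>e\<in>R. word_value S e \<odot>\<^bsub>S\<^esub> a = a" if "a \<in> A" for a
  proof -
    have a: "a \<in> carrier S" using that A by blast
    obtain t where t: "t \<in> carrier S" "(a \<odot>\<^bsub>S\<^esub> t) \<odot>\<^bsub>S\<^esub> a = a"
      using assms(2) a by (auto simp: sgp_regular_def)
    then have "a \<odot>\<^bsub>S\<^esub> t \<in> word_value S ` R" using a R(2) smult_closed by simp
    with t show ?thesis by force
  qed
  then obtain e where e: "\<And>a. a \<in> A \<Longrightarrow> e a \<in> R"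
    "\<And>a. a \<in> A \<Longrightarrow> word_value S (e a) \<odot>\<^bsub>S\<^esub> a = a"
    by metis
  have absorb: "word_value S (e a @ a # v) = word_value S (a # v)" if "a # v \<in> R" for a v
  proof -
    have "a # v \<in> nonempty_words A" using that R(1) by blast
    then have a: "a \<in> A" "a \<in> carrier S" and v: "v \<in> lists (carrier S)" using A by auto
    have ea: "e a \<in> nonempty_words (carrier S)" using e(1)[OF a(1)] RC by blast
    then have "word_value S (e a @ a # v) = word_value S (e a) \<odot>\<^bsub>S\<^esub> word_value S (a # v)"
      using a(2) v by (intro word_value_append) simp_all
    also have "\<dots> = word_value S (a # v)"
    proof (cases "v = []")
      case True
      then show ?thesis using e(2)[OF a(1)] by simp
    next
      case False
      then have "v \<in> nonempty_words (carrier S)" using v by (simp add: nonempty_words_def)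
      then show ?thesis
        using smult_assoc[OF word_value_closed[OF ea] a(2) word_value_closed, of v] False
        by (simp add: word_value_Cons e(2)[OF a(1)])
    qed
    finally show ?thesis .
  qed
  define Q where "Q a = {x. (map Letter (e a) @ [Hash1, Letter a]) @ x \<in> mult_table S R}" for a
  have Q_iff: "x \<in> Q a \<longleftrightarrow> (\<exists>v w. x = eq_word v w \<and> a # v \<in> R \<and> w \<in> R \<and>
    word_value S (a # v) = word_value S w)" if "a \<in> A" for a x
  proof
    assume "x \<in> Q a"
    then obtain u v w where uvw: "map Letter (e a) @ Hash1 # Letter a # x = mult_word u v w"
      "u \<in> R" "v \<in> R" "w \<in> R" "word_value S (u @ v) = word_value S w"
      unfolding Q_def mult_table_def by auto
    then have u: "u = e a" and v: "Letter a # x = eq_word v w"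
      using Hash1_split[of "e a" _ u] by auto
    obtain v' where "v = a # v'" "x = eq_word v' w"
      using v by (cases v) auto
    then show "\<exists>v w. x = eq_word v w \<and> a # v \<in> R \<and> w \<in> R \<and> word_value S (a # v) = word_value S w"
      using uvw absorb u by metis
  next
    assume "\<exists>v w. x = eq_word v w \<and> a # v \<in> R \<and> w \<in> R \<and> word_value S (a # v) = word_value S w"
    then obtain v w where x: "x = eq_word v w" and vw: "a # v \<in> R" "w \<in> R"
      "word_value S (a # v) = word_value S w" by blast
    have "mult_word (e a) (a # v) w \<in> mult_table S R"
      using vw(1,2) e(1)[OF that] HOL.trans[OF absorb[OF vw(1)] vw(3)] unfolding mult_table_def by blast
    then show "x \<in> Q a" by (simp add: Q_def x)
  qed
  define V where "V = insert None (Some ` A)"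
  \<comment> \<open>This two-level grammar forms a finite union of languages with a letter in front:
    \<open>None\<close> chooses the first letter and \<open>Some a\<close> expands to
    \<open>Q a\<close>.\<close>
  define H :: "'a option \<Rightarrow> ('a option + 'a marked) list set" where
    "H = case_option ((\<lambda>a. [Inr (Letter a), Inl (Some a)]) ` A) (\<lambda>a. map Inr ` Q a)"
  have "context_free {w. derives (Sigma V H) [Inl None] w}"
  proof (rule context_free_nested)
    show "finite V" using fin by (simp add: V_def)
    show "context_free (H v)" if "v \<in> V" for v
    proof (cases v)
      case None
      then show ?thesis using fin by (simp add: H_def context_free_finite)
    next
      case (Some a)
      then show ?thesis
        using cf unfolding H_def Q_def
        by (simp only: option.case) (intro context_free_map context_free_left_quotient)
    qed
  qed
  moreover have "derives (Sigma V H) [Inl None] w \<longleftrightarrow> w \<in> equality_table S R" for w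
  proof -
    have Some_iff: "derives (Sigma V H) [Inl (Some a)] x \<longleftrightarrow> x \<in> Q a" if "a \<in> A" for a x
      using that by (auto simp: derives_single_iff V_def H_def derives_terminals_iff)
    have "derives (Sigma V H) [Inl None] w \<longleftrightarrow>
        (\<exists>a\<in>A. derives (Sigma V H) [Inr (Letter a), Inl (Some a)] w)"
      by (auto simp: derives_single_iff V_def H_def)
    also have "\<dots> \<longleftrightarrow> (\<exists>a\<in>A. \<exists>x\<in>Q a. w = Letter a # x)"
    proof (rule bex_cong[OF HOL.refl])
      fix a assume "a \<in> A"
      then show "derives (Sigma V H) [Inr (Letter a), Inl (Some a)] w \<longleftrightarrow> (\<exists>x\<in>Q a. w = Letter a # x)"
        using Some_iff by (blast intro: derives_Inr)
    qed
    also have "\<dots> \<longleftrightarrow> w \<in> equality_table S R"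
    proof
      assume "\<exists>a\<in>A. \<exists>x\<in>Q a. w = Letter a # x"
      then obtain a v w' where "a \<in> A" "w = Letter a # eq_word v w'" "a # v \<in> R" "w' \<in> R"
        "word_value S (a # v) = word_value S w'" using Q_iff by blast
      moreover from this have "w = eq_word (a # v) w'" by simp
      ultimately show "w \<in> equality_table S R" unfolding equality_table_def by blast
    next
      assume "w \<in> equality_table S R"
      then obtain u w' where uw: "w = eq_word u w'" "u \<in> R" "w' \<in> R"
        "word_value S u = word_value S w'" unfolding equality_table_def by blast
      then have "u \<in> nonempty_words A" using R(1) by blast
      then obtain a v where u: "u = a # v" "a \<in> A"
        by (cases u) (auto simp: nonempty_words_def)
      then have "eq_word v w' \<in> Q a" using uw Q_iff by blast
      then show "\<exists>a\<in>A. \<exists>x\<in>Q a. w = Letter a # x" using u uw(1) by auto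
    qed
    finally show ?thesis .
  qed
  ultimately show ?thesis by simp
qed

section \<open>Alternating words\<close>

text \<open>A disjoint union of two semigroups, where \<open>tag\<close> tells the factor of an element.  Products
  across the factors are junk.\<close>

locale tagged_sgp =
  fixes Z :: "'m sgp" (structure) and tag :: "'m \<Rightarrow> bool"
  assumes tagged_closed: "\<lbrakk>x \<in> carrier Z; y \<in> carrier Z; tag x = tag y\<rbrakk> \<Longrightarrow> x \<odot> y \<in> carrier Z"
    and tag_smult: "\<lbrakk>x \<in> carrier Z; y \<in> carrier Z; tag x = tag y\<rbrakk> \<Longrightarrow> tag (x \<odot> y) = tag y"
    and tagged_assoc: "\<lbrakk>x \<in> carrier Z; y \<in> carrier Z; z \<in> carrier Z; tag x = tag y; tag y = tag z\<rbrakk>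
      \<Longrightarrow> (x \<odot> y) \<odot> z = x \<odot> (y \<odot> z)"
begin

text \<open>Left multiplication of an alternating sequence by one element. Only the head can merge:
  the product stays in its factor, so its tag still differs from that of the next entry.\<close>

fun push :: "'m \<Rightarrow> 'm list \<Rightarrow> 'm list" where
  "push x [] = [x]"
| "push x (y # ys) = (if tag x = tag y then (x \<odot> y) # ys else x # y # ys)"

definition normal_form :: "'m list \<Rightarrow> 'm list" where
  "normal_form w = foldr push w []"

lemma push_neq_Nil [simp]: "push x ys \<noteq> []"
  by (cases ys) auto

lemma push_closed:
  "x \<in> carrier Z \<Longrightarrow> set ys \<subseteq> carrier Z \<Longrightarrow> set (push x ys) \<subseteq> carrier Z"
  by (cases ys) (auto simp: tagged_closed)

lemma foldr_push_closed:
  "set xs \<subseteq> carrier Z \<Longrightarrow> set ys \<subseteq> carrier Z \<Longrightarrow> set (foldr push xs ys) \<subseteq> carrier Z"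
  by (induction xs) (use push_closed in auto)

lemma tag_hd_push:
  "x \<in> carrier Z \<Longrightarrow> set ys \<subseteq> carrier Z \<Longrightarrow> tag (hd (push x ys)) = tag x"
  by (cases ys) (auto simp: tag_smult)

text \<open>Associativity inside a factor enters here. It makes \<open>push\<close> an action of
  each factor on sequences, whether or not the head of \<open>zs\<close> merges.\<close>

lemma push_push:
  assumes "x \<in> carrier Z" "y \<in> carrier Z" "set zs \<subseteq> carrier Z" "tag x = tag y"
  shows "push x (push y zs) = push (x \<odot> y) zs"
  using assms by (cases zs) (auto simp: tagged_assoc tag_smult)

lemma foldr_push_push:
  assumes "x \<in> carrier Z" "set ys \<subseteq> carrier Z" "set zs \<subseteq> carrier Z"
  shows "foldr push (push x ys) zs = push x (foldr push ys zs)"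
  using assms by (cases ys) (auto simp: push_push foldr_push_closed)

text \<open>By \<open>foldr_push_push\<close> a single push may be performed before or after acting
  on \<open>zs\<close>. Hence a word acts on sequences only through its normal form, which is what
  lets normal forms be multiplied.\<close>

lemma foldr_normal_form:
  assumes "set xs \<subseteq> carrier Z" "set zs \<subseteq> carrier Z"
  shows "foldr push (normal_form xs) zs = foldr push xs zs"
  using assms
proof (induction xs)
  case (Cons x xs)
  then show ?case
    using foldr_push_closed[of xs "[]"] by (simp add: normal_form_def foldr_push_push)
qed (simp add: normal_form_def)

lemma normal_form_closed: "set xs \<subseteq> carrier Z \<Longrightarrow> set (normal_form xs) \<subseteq> carrier Z"
  by (simp add: normal_form_def foldr_push_closed)

lemma normal_form_append:
  assumes "set xs \<subseteq> carrier Z" "set ys \<subseteq> carrier Z"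
  shows "normal_form (xs @ ys) = foldr push (normal_form xs) (normal_form ys)"
  using assms normal_form_closed[of ys] by (simp add: foldr_normal_form) (simp add: normal_form_def)

text \<open>Repeated use of \<open>push_push\<close>. It takes the place of the lemmas on
  \<open>word_value\<close> in \<open>is_sgp\<close>, since \<open>Z\<close> behaves like a
  semigroup only within each factor.\<close>

lemma foldr_push_factor:
  assumes "u \<in> nonempty_words {m \<in> carrier Z. tag m = i}" "set zs \<subseteq> carrier Z"
  shows "word_value Z u \<in> carrier Z \<and> tag (word_value Z u) = i \<and>
    foldr push u zs = push (word_value Z u) zs"
  using assms(1)
proof (induction u)
  case (Cons a u)
  show ?case
  proof (cases "u = []")
    case False
    with Cons have "u \<in> nonempty_words {m \<in> carrier Z. tag m = i}"
      by (auto simp: nonempty_words_def)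
    with Cons False assms(2) show ?thesis
      by (auto simp: word_value_Cons push_push tagged_closed tag_smult)
  qed (use Cons in auto)
qed (simp add: nonempty_words_def)

end

text \<open>Nonterminals of the table grammar, from the outside inwards. \<open>LeftPart\<close>
  begins a syllable of the left argument: \<open>LeftEq\<close> copies it, \<open>LeftMult\<close>
  multiplies it with the first syllable of the right argument. After a copied syllable
  \<open>LeftRest\<close> goes on or crosses \<open>Hash1\<close>; \<open>RightPart\<close> and
  \<open>RightRest\<close> copy what remains of the right argument up to \<open>Hash2\<close>. The
  boolean is the factor of the syllable being written or just written.\<close>

datatype table_var =
    Table
  | LeftPart bool | LeftEq bool | LeftMult bool | LeftRest bool
  | RightPart bool | RightRest bool

locale tagged_combing = tagged_sgp +
  fixes L :: "bool \<Rightarrow> 'a list set"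
  assumes L_words: "L i \<subseteq> nonempty_words {m \<in> carrier Z. tag m = i}"
begin

lemma L_closed: "u \<in> L i \<Longrightarrow> u \<noteq> [] \<and> set u \<subseteq> carrier Z \<and> word_value Z u \<in> carrier Z \<and>
    tag (word_value Z u) = i"
  using L_words[of i] foldr_push_factor[of u i "[]"] by (auto simp: nonempty_words_def)

lemma foldr_push_L: "u \<in> L i \<Longrightarrow> set zs \<subseteq> carrier Z \<Longrightarrow> foldr push u zs = push (word_value Z u) zs"
  using L_words[of i] foldr_push_factor[of u i zs] by blast

text \<open>The last argument lists the values of the syllables. It is recorded because it turns out
  to be the normal form of the word, whereas the word need not be determined by it.\<close>

inductive alternating :: "bool \<Rightarrow> 'a list \<Rightarrow> 'a list \<Rightarrow> bool" where
  single: "u \<in> L i \<Longrightarrow> alternating i u [word_value Z u]"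
| Cons: "u \<in> L i \<Longrightarrow> alternating (\<not> i) x ss \<Longrightarrow> alternating i (u @ x) (word_value Z u # ss)"

text \<open>Neighbouring syllables carry different tags, so folding \<open>push\<close> over a
  syllable just puts its value in front.\<close>

lemma alternating_normal_form:
  "alternating i u ss \<Longrightarrow> u \<noteq> [] \<and> set u \<subseteq> carrier Z \<and> normal_form u = ss \<and> ss \<noteq> [] \<and>
    set ss \<subseteq> carrier Z \<and> tag (hd ss) = i"
proof (induction rule: alternating.induct)
  case (single u i)
  then show ?case using L_closed[of u i] by (simp add: normal_form_def foldr_push_L)
next
  case (Cons u i x ss)
  then show ?case using L_closed[of u i]
    by (cases ss) (auto simp: normal_form_def foldr_push_L)
qed

definition alternating_words :: "'a list set" where
  "alternating_words = {u. \<exists>i ss. alternating i u ss}"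

section \<open>A grammar for the multiplication table of the free product\<close>

definition free_table :: "'a marked list set" where
  "free_table = {mult_word u v w | u v w. u \<in> alternating_words \<and> v \<in> alternating_words \<and>
     w \<in> alternating_words \<and> normal_form (u @ v) = normal_form w}"

text \<open>The centre \<open>Hash2\<close> of a table word gives way to the nonterminal for the
  next inner layer. A \<open>Hash1\<close> stays: it is the one of the final word. Being a letter
  map, this keeps languages context-free.\<close>

definition plug :: "table_var \<Rightarrow> 'a marked list set \<Rightarrow> (table_var + 'a marked) list set" where
  "plug X K = map (\<lambda>x. if x = Hash2 then Inl X else Inr x) ` K"

text \<open>When \<open>LeftRest i\<close> crosses \<open>Hash1\<close>, the right argument starts
  in the other factor. If it starts in factor \<open>i\<close> instead, the last syllable of the
  left argument has to go through \<open>LeftMult\<close>.\<close>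

fun table_prods :: "table_var \<Rightarrow> (table_var + 'a marked) list set" where
  "table_prods Table = {[Inl (LeftPart True)], [Inl (LeftPart False)]}"
| "table_prods (LeftPart i) = {[Inl (LeftEq i)], [Inl (LeftMult i)]}"
| "table_prods (LeftEq i) = plug (LeftRest i) (equality_table Z (L i))"
| "table_prods (LeftMult i) = plug (RightRest i) (mult_table Z (L i))"
| "table_prods (LeftRest i) = {[Inl (LeftPart (\<not> i))], [Inr Hash1, Inl (RightPart (\<not> i))]}"
| "table_prods (RightPart i) = plug (RightRest i) (equality_table Z (L i))"
| "table_prods (RightRest i) = {[Inr Hash2], [Inl (RightPart (\<not> i))]}"

abbreviation "table_grammar \<equiv> Sigma UNIV table_prods"

definition right_words :: "bool \<Rightarrow> 'a marked list set" where
  "right_words i = {eq_word v w | v w. \<exists>ts. alternating i v ts \<and> alternating i w ts}"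

definition left_words :: "bool \<Rightarrow> 'a marked list set" where
  "left_words i = {mult_word u v w | u v w. \<exists>j ss ts.
     alternating i u ss \<and> alternating j v ts \<and> alternating i w (foldr push ss ts)}"

text \<open>A family of languages closed under the productions. For \<open>LeftEq\<close> and
  \<open>LeftMult\<close> it is just the upper bound \<open>left_words i\<close>, which is all that
  soundness asks for.\<close>

fun table_words :: "table_var \<Rightarrow> 'a marked list set" where
  "table_words Table = left_words True \<union> left_words False"
| "table_words (LeftPart i) = left_words i"
| "table_words (LeftEq i) = left_words i"
| "table_words (LeftMult i) = left_words i"
| "table_words (LeftRest i) = left_words (\<not> i) \<union> Cons Hash1 ` right_words (\<not> i)"
| "table_words (RightPart i) = right_words i"
| "table_words (RightRest i) = insert [Hash2] (right_words (\<not> i))"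

section \<open>Soundness of the table grammar\<close>

lemma plug_equality_table:
  "plug X (equality_table Z K) =
    {map Inr (map Letter u) @ Inl X # map Inr (map Letter (rev w)) | u w.
      u \<in> K \<and> w \<in> K \<and> word_value Z u = word_value Z w}"
  unfolding plug_def equality_table_def by (auto simp: image_iff) force+

lemma plug_mult_table:
  "plug X (mult_table Z K) =
    {map Inr (map Letter u @ Hash1 # map Letter v) @ Inl X # map Inr (map Letter (rev w)) | u v w.
      u \<in> K \<and> v \<in> K \<and> w \<in> K \<and> word_value Z (u @ v) = word_value Z w}"
  unfolding plug_def mult_table_def by (auto simp: image_iff) force+

lemma right_words_nest:
  assumes "u \<in> L i" "w \<in> L i" "word_value Z u = word_value Z w" "x \<in> table_words (RightRest i)"
  shows "map Letter u @ x @ map Letter (rev w) \<in> right_words i"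
proof (cases "x = [Hash2]")
  case True
  then show ?thesis using assms(1-3) alternating.single[of u i] alternating.single[of w i]
    unfolding right_words_def by auto
next
  case False
  then obtain v w' ts where x: "x = eq_word v w'" "alternating (\<not> i) v ts" "alternating (\<not> i) w' ts"
    using assms(4) by (auto simp: right_words_def)
  then have "alternating i (u @ v) (word_value Z u # ts)" "alternating i (w @ w') (word_value Z u # ts)"
    using assms(1-3) alternating.Cons by metis+
  moreover have "map Letter u @ x @ map Letter (rev w) = eq_word (u @ v) (w @ w')" by (simp add: x(1))
  ultimately show ?thesis unfolding right_words_def by blast
qed

text \<open>Both when the left argument goes on and when it ends here, the sequence behind
  \<open>word_value Z u\<close> begins in the other factor. Pushing this value therefore merges
  nothing, and it reappears in front of the product.\<close>

lemma left_words_nest: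
  assumes uw: "u \<in> L i" "w \<in> L i" "word_value Z u = word_value Z w"
    and "x \<in> table_words (LeftRest i)"
  shows "map Letter u @ x @ map Letter (rev w) \<in> left_words i"
  using assms(4) unfolding table_words.simps
proof
  assume "x \<in> left_words (\<not> i)"
  then obtain u' v w' j ss ts where x: "x = mult_word u' v w'" and alt: "alternating (\<not> i) u' ss"
    "alternating j v ts" "alternating (\<not> i) w' (foldr push ss ts)"
    unfolding left_words_def by auto
  have "foldr push (word_value Z u # ss) ts = word_value Z u # foldr push ss ts"
    using alternating_normal_form[OF alt(3)] L_closed[OF uw(1)]
    by (cases "foldr push ss ts") auto
  then have "alternating i (u @ u') (word_value Z u # ss)"
    "alternating i (w @ w') (foldr push (word_value Z u # ss) ts)"
    using alt uw alternating.Cons by metis+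
  moreover have "map Letter u @ x @ map Letter (rev w) = mult_word (u @ u') v (w @ w')"
    by (simp add: x)
  ultimately show ?thesis unfolding left_words_def using alt(2) by blast
next
  assume "x \<in> Cons Hash1 ` right_words (\<not> i)"
  then obtain v w' ts where x: "x = Hash1 # eq_word v w'" and alt: "alternating (\<not> i) v ts"
    "alternating (\<not> i) w' ts" unfolding right_words_def by auto
  have "foldr push [word_value Z u] ts = word_value Z u # ts"
    using alternating_normal_form[OF alt(1)] L_closed[OF uw(1)] by (cases ts) auto
  then have "alternating i (w @ w') (foldr push [word_value Z u] ts)"
    using alt uw alternating.Cons by metis
  moreover have "map Letter u @ x @ map Letter (rev w) = mult_word u v (w @ w')"
    by (simp add: x)
  ultimately show ?thesis unfolding left_words_def using alt(1) alternating.single[OF uw(1)] by blast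
qed

text \<open>Both sides are the single entry of the same pushed sequence, with the concatenation read
  once as one word of the factor and once as two.\<close>

lemma word_value_append_L:
  assumes "u \<in> L i" "v \<in> L i"
  shows "word_value Z (u @ v) = word_value Z u \<odot> word_value Z v"
proof -
  have "u @ v \<in> nonempty_words {m \<in> carrier Z. tag m = i}"
    using assms L_words[of i] by (intro nonempty_words_append) auto
  from foldr_push_factor[OF this, of "[]"] have "[word_value Z (u @ v)] = foldr push u (foldr push v [])"
    by simp
  also have "\<dots> = [word_value Z u \<odot> word_value Z v]"
    using assms L_closed[of u i] L_closed[of v i] by (simp add: foldr_push_L)
  finally show ?thesis by simp
qed

text \<open>Here syllables merge: pushing the value of \<open>u\<close> multiplies the head of the
  right argument's sequence and leaves its tail, which is copied by \<open>x\<close>.\<close>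

lemma left_words_mult:
  assumes uvw: "u \<in> L i" "v \<in> L i" "w \<in> L i" "word_value Z (u @ v) = word_value Z w"
    and x: "x \<in> table_words (RightRest i)"
  shows "map Letter u @ Hash1 # map Letter v @ x @ map Letter (rev w) \<in> left_words i"
proof -
  have tags: "tag (word_value Z u) = tag (word_value Z v)"
    using L_closed[OF uvw(1)] L_closed[OF uvw(2)] by simp
  have val: "word_value Z u \<odot> word_value Z v = word_value Z w"
    using word_value_append_L[OF uvw(1,2)] uvw(4) by simp
  show ?thesis
  proof (cases "x = [Hash2]")
    case True
    have "alternating i w (foldr push [word_value Z u] [word_value Z v])"
      using alternating.single[OF uvw(3)] tags val by simp
    then have "mult_word u v w \<in> left_words i"
      using alternating.single[OF uvw(1)] alternating.single[OF uvw(2)]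
      unfolding left_words_def by blast
    then show ?thesis by (simp add: True)
  next
    case False
    then obtain v' w' ts where x': "x = eq_word v' w'" and alt: "alternating (\<not> i) v' ts"
      "alternating (\<not> i) w' ts" using x by (auto simp: right_words_def)
    have "alternating i (w @ w') (foldr push [word_value Z u] (word_value Z v # ts))"
      using alternating.Cons[OF uvw(3) alt(2)] tags val by simp
    moreover have "map Letter u @ Hash1 # map Letter v @ x @ map Letter (rev w) =
        mult_word u (v @ v') (w @ w')" by (simp add: x')
    ultimately show ?thesis
      using alternating.single[OF uvw(1)] alternating.Cons[OF uvw(2) alt(1)]
      unfolding left_words_def by blast
  qed
qed

lemma expand_table_prods: "\<beta> \<in> table_prods X \<Longrightarrow> expand_form table_words \<beta> \<subseteq> table_words X"
proof (cases X)
  case (LeftEq i)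
  assume "\<beta> \<in> table_prods X"
  then obtain u w where uw: "u \<in> L i" "w \<in> L i" "word_value Z u = word_value Z w"
    and \<beta>: "\<beta> = map Inr (map Letter u) @ Inl (LeftRest i) # map Inr (map Letter (rev w))"
    unfolding LeftEq table_prods.simps plug_equality_table by blast
  show ?thesis unfolding \<beta> expand_form_surround
    using left_words_nest[OF uw] unfolding LeftEq table_words.simps(3) by blast
next
  case (LeftMult i)
  assume "\<beta> \<in> table_prods X"
  then obtain u v w where uvw: "u \<in> L i" "v \<in> L i" "w \<in> L i" "word_value Z (u @ v) = word_value Z w"
    and \<beta>: "\<beta> = map Inr (map Letter u @ Hash1 # map Letter v) @ Inl (RightRest i) #
      map Inr (map Letter (rev w))" unfolding LeftMult table_prods.simps plug_mult_table by blast
  show ?thesis unfolding \<beta> expand_form_surround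
    using left_words_mult[OF uvw] by (auto simp: LeftMult)
next
  case (RightPart i)
  assume "\<beta> \<in> table_prods X"
  then obtain u w where uw: "u \<in> L i" "w \<in> L i" "word_value Z u = word_value Z w"
    and \<beta>: "\<beta> = map Inr (map Letter u) @ Inl (RightRest i) # map Inr (map Letter (rev w))"
    unfolding RightPart table_prods.simps plug_equality_table by blast
  show ?thesis unfolding \<beta> expand_form_surround
    using right_words_nest[OF uw] unfolding RightPart table_words.simps(6) by blast
qed auto

lemma table_grammar_sound: "derives table_grammar [Inl X] w \<Longrightarrow> w \<in> table_words X"
  using derives_sound[of table_grammar table_words "[Inl X]" w] expand_table_prods by auto

section \<open>Completeness of the table grammar\<close>

abbreviation "generated X w \<equiv> derives table_grammar [Inl X] w"

lemma generated_nest: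
  assumes "u \<in> L i" "w \<in> L i" "word_value Z u = word_value Z w"
  shows "generated (LeftRest i) x \<Longrightarrow> generated (LeftEq i) (map Letter u @ x @ map Letter (rev w))"
    and "generated (RightRest i) x \<Longrightarrow> generated (RightPart i) (map Letter u @ x @ map Letter (rev w))"
proof -
  let ?\<beta> = "\<lambda>X. map Inr (map Letter u) @ Inl X # map Inr (map Letter (rev w))"
  have "?\<beta> X \<in> plug X (equality_table Z (L i))" for X
    using assms unfolding plug_equality_table by blast
  then have *: "(LeftEq i, ?\<beta> (LeftRest i)) \<in> table_grammar" "(RightPart i, ?\<beta> (RightRest i)) \<in> table_grammar"
    by auto
  show "generated (LeftRest i) x \<Longrightarrow> generated (LeftEq i) (map Letter u @ x @ map Letter (rev w))"
    using *(1) derives_surround[of table_grammar "LeftRest i" x "map Letter u" "map Letter (rev w)"]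
    unfolding derives_single_iff[of _ "LeftEq i"] by blast
  show "generated (RightRest i) x \<Longrightarrow> generated (RightPart i) (map Letter u @ x @ map Letter (rev w))"
    using *(2) derives_surround[of table_grammar "RightRest i" x "map Letter u" "map Letter (rev w)"]
    unfolding derives_single_iff[of _ "RightPart i"] by blast
qed

lemma generated_mult:
  assumes "u \<in> L i" "v \<in> L i" "w \<in> L i" "word_value Z (u @ v) = word_value Z w"
    and "generated (RightRest i) x"
  shows "generated (LeftMult i) (map Letter u @ Hash1 # map Letter v @ x @ map Letter (rev w))"
proof -
  let ?\<beta> = "map Inr (map Letter u @ Hash1 # map Letter v) @ Inl (RightRest i) # map Inr (map Letter (rev w))"
  have "?\<beta> \<in> table_prods (LeftMult i)"
    using assms(1-4) unfolding table_prods.simps plug_mult_table by blast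
  then have "(LeftMult i, ?\<beta>) \<in> table_grammar" by simp
  moreover have "derives table_grammar ?\<beta> ((map Letter u @ Hash1 # map Letter v) @ x @ map Letter (rev w))"
    by (rule derives_surround) fact
  ultimately show ?thesis unfolding derives_single_iff[of _ "LeftMult i"] by auto
qed

lemma generated_choice:
  "generated (LeftEq i) x \<Longrightarrow> generated (LeftPart i) x"
  "generated (LeftMult i) x \<Longrightarrow> generated (LeftPart i) x"
  "generated (LeftPart i) x \<Longrightarrow> generated Table x"
  "generated (LeftPart (\<not> i)) x \<Longrightarrow> generated (LeftRest i) x"
  "generated (RightPart (\<not> i)) x \<Longrightarrow> generated (LeftRest i) (Hash1 # x)"
  "generated (RightPart (\<not> i)) x \<Longrightarrow> generated (RightRest i) x"
  "generated (RightRest i) [Hash2]"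
proof -
  have step: "derives table_grammar \<beta> y \<Longrightarrow> \<beta> \<in> table_prods X \<Longrightarrow> generated X y" for X \<beta> y
    unfolding derives_single_iff[of _ X] by blast
  show "generated (LeftEq i) x \<Longrightarrow> generated (LeftPart i) x"
    by (erule step) simp
  show "generated (LeftMult i) x \<Longrightarrow> generated (LeftPart i) x"
    by (erule step) simp
  show "generated (LeftPart i) x \<Longrightarrow> generated Table x"
    by (erule step) (cases i, simp_all)
  show "generated (LeftPart (\<not> i)) x \<Longrightarrow> generated (LeftRest i) x"
    by (erule step) simp
  show "generated (RightPart (\<not> i)) x \<Longrightarrow> generated (LeftRest i) (Hash1 # x)"
    by (drule derives_Inr, erule step) simp
  show "generated (RightPart (\<not> i)) x \<Longrightarrow> generated (RightRest i) x"
    by (erule step) simp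
  show "generated (RightRest i) [Hash2]"
    by (rule step[OF derives_Inr[OF derives_Nil]]) simp
qed

lemma alternating_singleE:
  assumes "alternating j w [s]" obtains "w \<in> L j" "s = word_value Z w"
  using assms
proof cases
  case (Cons u x)
  then show ?thesis using alternating_normal_form[of "\<not> j" x "[]"] by simp
qed auto

lemma alternating_ConsE:
  assumes "alternating j w (s # ss)" "ss \<noteq> []"
  obtains u x where "w = u @ x" "u \<in> L j" "s = word_value Z u" "alternating (\<not> j) x ss"
  using assms by cases auto

text \<open>A common list of values forces the same number of syllables and the same factors, so
  both words can be peeled one syllable at a time although the syllables may be spelt
  differently.\<close>

lemma generated_right:
  "alternating i v ts \<Longrightarrow> alternating j w ts \<Longrightarrow> generated (RightPart i) (eq_word v w)"
proof (induction arbitrary: j w rule: alternating.induct)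
  case (single u i)
  then have "j = i"
    using alternating_normal_form[of j w "[word_value Z u]"] L_closed[of u i] by simp
  with single show ?case
    using generated_nest(2)[of u i w, OF _ _ _ generated_choice(7)] by (auto elim: alternating_singleE)
next
  case (Cons u i x ss)
  then have "j = i"
    using alternating_normal_form[of j w "word_value Z u # ss"] L_closed[of u i] by simp
  have "ss \<noteq> []" using alternating_normal_form[OF Cons.hyps(2)] by simp
  then obtain u' w' where w: "w = u' @ w'" "u' \<in> L i" "word_value Z u = word_value Z u'"
    "alternating (\<not> i) w' ss"
    using Cons.prems \<open>j = i\<close> by (auto elim: alternating_ConsE)
  from generated_nest(2)[OF Cons.hyps(1) w(2,3) generated_choice(6)[OF Cons.IH[OF w(4)]]]
  show ?case by (simp add: w(1))
qed

text \<open>Induction on the syllables of the left argument. All but the last are copied, because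
  the inner product still begins in the other factor. At the last one the choice depends on whether
  the right argument starts in the same factor and on whether it has more than one syllable.\<close>

lemma generated_left:
  "alternating i u ss \<Longrightarrow> alternating j v ts \<Longrightarrow> alternating k w (foldr push ss ts) \<Longrightarrow>
    generated (LeftPart i) (mult_word u v w)"
proof (induction arbitrary: k w rule: alternating.induct)
  case (single u i)
  let ?s = "word_value Z u"
  have u: "?s \<in> carrier Z" "tag ?s = i" using L_closed[OF single.hyps] by auto
  have ts: "ts \<noteq> []" "set ts \<subseteq> carrier Z" "tag (hd ts) = j"
    using alternating_normal_form[OF single.prems(1)] by auto
  \<comment> \<open>A push leaves the tag of the pushed element in front, merged or not, so
    \<open>w\<close> begins in the factor in which \<open>u\<close> begins.\<close>
  have k: "k = i"
    using alternating_normal_form[OF single.prems(2)] tag_hd_push[OF u(1) ts(2)] u(2) by simp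
  show ?case
  proof (cases "j = i")
    case False
    then have "push ?s ts = ?s # ts" using u ts by (cases ts) auto
    with single.prems(2) ts(1) k obtain u' w' where w: "w = u' @ w'" "u' \<in> L i" "?s = word_value Z u'"
      "alternating (\<not> i) w' ts"
      by (auto elim: alternating_ConsE)
    have j: "j = (\<not> i)" using False by simp
    have "generated (LeftRest i) (Hash1 # eq_word v w')"
      using generated_choice(5) generated_right single.prems(1) w(4) unfolding j by blast
    from generated_choice(1)[OF generated_nest(1)[OF single.hyps w(2,3) this]]
    show ?thesis by (simp add: w(1))
  next
    case True
    obtain t ts' where t: "ts = t # ts'" using ts(1) by (cases ts) auto
    have push: "push ?s ts = (?s \<odot> t) # ts'" using u ts(3) True t by simp
    show ?thesis
    proof (cases "ts' = []")
      case True
      then have v: "v \<in> L i" "t = word_value Z v"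
        using single.prems(1) t \<open>j = i\<close> by (auto elim: alternating_singleE)
      have w: "w \<in> L i" "?s \<odot> t = word_value Z w"
        using single.prems(2) push True k by (auto elim: alternating_singleE)
      have "word_value Z (u @ v) = word_value Z w"
        using word_value_append_L[OF single.hyps v(1)] v(2) w(2) by simp
      from generated_choice(2)[OF generated_mult[OF single.hyps v(1) w(1) this generated_choice(7)]]
      show ?thesis by simp
    next
      case False
      then obtain v1 v2 where v: "v = v1 @ v2" "v1 \<in> L i" "t = word_value Z v1" "alternating (\<not> i) v2 ts'"
        using single.prems(1) t \<open>j = i\<close> by (auto elim: alternating_ConsE)
      obtain w1 w2 where w: "w = w1 @ w2" "w1 \<in> L i" "?s \<odot> t = word_value Z w1"
        "alternating (\<not> i) w2 ts'"
        using single.prems(2) push False k by (auto elim: alternating_ConsE)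
      have "word_value Z (u @ v1) = word_value Z w1"
        using word_value_append_L[OF single.hyps v(2)] v(3) w(3) by simp
      from generated_choice(2)[OF generated_mult[OF single.hyps v(2) w(2) this
          generated_choice(6)[OF generated_right[OF v(4) w(4)]]]]
      show ?thesis by (simp add: v(1) w(1))
    qed
  qed
next
  case (Cons u i x ss)
  let ?s = "word_value Z u"
  have u: "?s \<in> carrier Z" "tag ?s = i" using L_closed[OF Cons.hyps(1)] by auto
  have ss: "ss \<noteq> []" "set ss \<subseteq> carrier Z" "tag (hd ss) = (\<not> i)"
    using alternating_normal_form[OF Cons.hyps(2)] by auto
  have ts: "set ts \<subseteq> carrier Z"
    using alternating_normal_form[OF Cons.prems(1)] by auto
  obtain s' ss' where s': "ss = s' # ss'" using ss(1) by (cases ss) auto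
  have closed: "set (foldr push ss ts) \<subseteq> carrier Z" and "set (foldr push ss' ts) \<subseteq> carrier Z"
    using ss(2) ts foldr_push_closed[of ss ts] foldr_push_closed[of ss' ts] by (simp_all add: s')
  \<comment> \<open>Whatever is merged further inside, the head of the inner product keeps the tag
    of \<open>s'\<close>.\<close>
  then have ne: "foldr push ss ts \<noteq> []" and hd: "tag (hd (foldr push ss ts)) = (\<not> i)"
    using ss tag_hd_push[of s' "foldr push ss' ts"] by (auto simp: s')
  have k: "k = i"
    using alternating_normal_form[OF Cons.prems(2)] tag_hd_push[OF u(1) closed] u(2) by simp
  have "foldr push (?s # ss) ts = ?s # foldr push ss ts"
    using u(2) ne hd by (cases "foldr push ss ts") auto
  then have "alternating i w (?s # foldr push ss ts)" using Cons.prems(2) k by simp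
  then obtain w1 w2 where w: "w = w1 @ w2" "w1 \<in> L i" "?s = word_value Z w1"
    "alternating (\<not> i) w2 (foldr push ss ts)"
    using ne by (rule alternating_ConsE)
  from generated_choice(1)[OF generated_nest(1)[OF Cons.hyps(1) w(2,3)
      generated_choice(4)[OF Cons.IH[OF Cons.prems(1) w(4)]]]]
  show ?case by (simp add: w(1))
qed

lemma free_table_generated: "free_table = {w. generated Table w}"
proof (intro Set.set_eqI iffI)
  fix x assume "x \<in> free_table"
  then obtain u v w i ss j ts k rs where x: "x = mult_word u v w"
    and alt: "alternating i u ss" "alternating j v ts" "alternating k w rs"
    and nf: "normal_form (u @ v) = normal_form w"
    unfolding free_table_def alternating_words_def by blast
  \<comment> \<open>\<open>normal_form\<close> recovers the value list of an alternating word, so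
    equality of normal forms turns into an identity between value lists.\<close>
  have "rs = foldr push ss ts"
    using alt[THEN alternating_normal_form] nf by (simp add: normal_form_append)
  with alt show "x \<in> {w. generated Table w}"
    unfolding x using generated_choice(3) generated_left by blast
next
  fix x assume "x \<in> {w. generated Table w}"
  then have "x \<in> left_words True \<union> left_words False"
    using table_grammar_sound[of Table x] by simp
  then obtain u v w i ss j ts where x: "x = mult_word u v w"
    and alt: "alternating i u ss" "alternating j v ts" "alternating i w (foldr push ss ts)"
    unfolding left_words_def by blast
  have "normal_form (u @ v) = normal_form w"
    using alt[THEN alternating_normal_form] by (simp add: normal_form_append)
  with alt show "x \<in> free_table"
    unfolding free_table_def alternating_words_def x by blast
qed

lemma context_free_free_table:
  assumes "\<And>i. context_free (mult_table Z (L i))" "\<And>i. context_free (equality_table Z (L i))"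
  shows "context_free free_table"
proof -
  have "(UNIV :: table_var set) = insert Table (LeftPart ` UNIV \<union> LeftEq ` UNIV \<union> LeftMult ` UNIV \<union>
      LeftRest ` UNIV \<union> RightPart ` UNIV \<union> RightRest ` UNIV)"
  proof (intro Set.set_eqI iffI)
    fix X :: table_var
    show "X \<in> insert Table (LeftPart ` UNIV \<union> LeftEq ` UNIV \<union> LeftMult ` UNIV \<union>
      LeftRest ` UNIV \<union> RightPart ` UNIV \<union> RightRest ` UNIV)"
      by (cases X) simp_all
  qed simp
  then have "finite (UNIV :: table_var set)"
    by (metis finite_insert finite_Un finite_imageI finite)
  moreover have "context_free (table_prods X)" for X
    by (cases X) (simp_all add: plug_def assms context_free_map context_free_finite)
  ultimately show ?thesis unfolding free_table_generated by (intro context_free_nested)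
qed

end

section \<open>Regularity of the alternating words\<close>

lemma foldl_closed:
  assumes "\<forall>q\<in>Q. \<forall>a\<in>A. \<delta> q a \<in> Q"
  shows "q \<in> Q \<Longrightarrow> w \<in> lists A \<Longrightarrow> foldl \<delta> q w \<in> Q"
  by (induction w arbitrary: q) (use assms in auto)

lemma regular_languageI:
  fixes Q :: "'s set"
  assumes "finite Q" "q0 \<in> Q" "F \<subseteq> Q" and closed: "\<forall>q\<in>Q. \<forall>a\<in>A. \<delta> q a \<in> Q"
    and L: "L = {w \<in> lists A. foldl \<delta> q0 w \<in> F}"
  shows "regular_language A L"
proof -
  obtain f :: "'s \<Rightarrow> nat" where f: "inj_on f Q"
    using finite_imp_inj_to_nat_seg[OF \<open>finite Q\<close>] by blast
  define \<delta>' where "\<delta>' n a = f (\<delta> (inv_into Q f n) a)" for n a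
  have run: "foldl \<delta>' (f q) w = f (foldl \<delta> q w)" if "q \<in> Q" "w \<in> lists A" for q w
    using that by (induction w arbitrary: q) (use f closed in \<open>auto simp: \<delta>'_def\<close>)
  have "f (foldl \<delta> q0 w) \<in> f ` F \<longleftrightarrow> foldl \<delta> q0 w \<in> F" if "w \<in> lists A" for w
    using inj_on_image_mem_iff[OF f _ \<open>F \<subseteq> Q\<close>] foldl_closed[OF closed \<open>q0 \<in> Q\<close> that] by blast
  then have "L = {w \<in> lists A. foldl \<delta>' (f q0) w \<in> f ` F}"
    unfolding L using run[OF \<open>q0 \<in> Q\<close>] by (metis (no_types, lifting))
  moreover have "\<forall>n\<in>f ` Q. \<forall>a\<in>A. \<delta>' n a \<in> f ` Q"
    using f closed by (auto simp: \<delta>'_def)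
  ultimately show ?thesis
    unfolding regular_language_def using assms(1-3)
    by (intro exI[of _ "f ` Q"] exI[of _ "f q0"] exI[of _ \<delta>'] exI[of _ "f ` F"]) auto
qed

text \<open>Injectivity lets the automaton read each image letter back, so it keeps its
  states.\<close>

lemma regular_language_map:
  assumes "regular_language A L" and f: "inj_on f A"
  shows "regular_language (f ` A) (map f ` L)"
proof -
  obtain Q :: "nat set" and q0 \<delta> F where Q: "finite Q" "q0 \<in> Q" "F \<subseteq> Q"
    and closed: "\<forall>q\<in>Q. \<forall>a\<in>A. \<delta> q a \<in> Q" and L: "L = {w \<in> lists A. foldl \<delta> q0 w \<in> F}"
    using assms(1) unfolding regular_language_def by auto
  define \<delta>' where "\<delta>' q b = \<delta> q (inv_into A f b)" for q b
  have run: "foldl \<delta>' q (map f w) = foldl \<delta> q w" if "w \<in> lists A" for q w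
    using that by (induction w arbitrary: q) (use f in \<open>auto simp: \<delta>'_def\<close>)
  have "{w \<in> lists (f ` A). foldl \<delta>' q0 w \<in> F} = map f ` {w \<in> lists A. foldl \<delta>' q0 (map f w) \<in> F}"
    unfolding lists_image by blast
  also have "{w \<in> lists A. foldl \<delta>' q0 (map f w) \<in> F} = L"
    unfolding L by (rule Collect_cong) (simp add: run cong: conj_cong)
  finally have "map f ` L = {w \<in> lists (f ` A). foldl \<delta>' q0 w \<in> F}" by (rule HOL.sym)
  then show ?thesis
    using Q closed f by (intro regular_languageI[of Q q0 F]) (auto simp: \<delta>'_def)
qed

text \<open>\<open>Inside i q\<close> stands for an unfinished syllable of factor \<open>i\<close>,
  in which the automaton of \<open>L i\<close> has reached the state \<open>q\<close>.\<close>

datatype alt_state = Initial | Dead | Inside bool nat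

context tagged_combing
begin

lemma alternating_iff:
  "(\<exists>ss. alternating i u ss) \<longleftrightarrow>
    (\<exists>x y. u = x @ y \<and> x \<in> L i \<and> (y = [] \<or> (\<exists>ss. alternating (\<not> i) y ss)))"
proof
  assume "\<exists>ss. alternating i u ss"
  then obtain ss where "alternating i u ss" by blast
  then show "\<exists>x y. u = x @ y \<and> x \<in> L i \<and> (y = [] \<or> (\<exists>ss. alternating (\<not> i) y ss))"
    by cases (metis append_Nil2, metis)
next
  assume "\<exists>x y. u = x @ y \<and> x \<in> L i \<and> (y = [] \<or> (\<exists>ss. alternating (\<not> i) y ss))"
  then obtain x y where "u = x @ y" "x \<in> L i" "y = [] \<or> (\<exists>ss. alternating (\<not> i) y ss)"
    by blast
  then show "\<exists>ss. alternating i u ss"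
    using alternating.single[of x i] alternating.Cons[of x i y] by auto
qed

lemma tag_hd_alternating: "alternating i u ss \<Longrightarrow> u \<noteq> [] \<and> tag (hd u) = i"
proof (induction rule: alternating.induct)
  case (single u i)
  then show ?case using L_words[of i] by (cases u) (auto simp: nonempty_words_def)
next
  case (Cons u i x ss)
  then show ?case using L_words[of i] by (cases u) (auto simp: nonempty_words_def)
qed

lemma alternating_lists: "(\<And>i. L i \<subseteq> lists B) \<Longrightarrow> alternating i u ss \<Longrightarrow> u \<in> lists B"
  by (rotate_tac, induction rule: alternating.induct) (blast, simp, blast)

text \<open>A change of tag reveals the end of a syllable, so a deterministic automaton suffices: it
  simulates the automaton of the current factor and, when the tag changes, checks acceptance before
  it turns to the other one.\<close>

lemma regular_alternating_words:
  assumes reg: "\<And>i. regular_language {b \<in> B. tag b = i} (L i)"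
  shows "regular_language B alternating_words"
proof -
  have "\<forall>i. \<exists>(Q::nat set) q0 \<delta> F. finite Q \<and> q0 \<in> Q \<and> F \<subseteq> Q \<and>
      (\<forall>q\<in>Q. \<forall>a\<in>{b \<in> B. tag b = i}. \<delta> q a \<in> Q) \<and>
      L i = {w \<in> lists {b \<in> B. tag b = i}. foldl \<delta> q0 w \<in> F}"
    using reg unfolding regular_language_def by blast
  then obtain Q :: "bool \<Rightarrow> nat set" and q0 \<delta> F where
    "\<forall>i. finite (Q i) \<and> q0 i \<in> Q i \<and> F i \<subseteq> Q i \<and>
      (\<forall>q\<in>Q i. \<forall>a\<in>{b \<in> B. tag b = i}. \<delta> i q a \<in> Q i) \<and>
      L i = {w \<in> lists {b \<in> B. tag b = i}. foldl (\<delta> i) (q0 i) w \<in> F i}"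
    unfolding choice_iff by (elim exE)
  then have Q: "\<And>i. finite (Q i)" "\<And>i. q0 i \<in> Q i" "\<And>i. F i \<subseteq> Q i"
    and closed: "\<And>i q a. q \<in> Q i \<Longrightarrow> a \<in> B \<Longrightarrow> tag a = i \<Longrightarrow> \<delta> i q a \<in> Q i"
    and L: "\<And>i. L i = {w \<in> lists {b \<in> B. tag b = i}. foldl (\<delta> i) (q0 i) w \<in> F i}"
    by auto
  \<comment> \<open>The letter that reveals a new syllable is already its first one, so the initial
    state of the factor's automaton is left in the same step and no empty syllable arises.\<close>
  define enter where "enter a = Inside (tag a) (\<delta> (tag a) (q0 (tag a)) a)" for a
  define step where "step s a = (case s of Initial \<Rightarrow> enter a | Dead \<Rightarrow> Dead
    | Inside i q \<Rightarrow> if tag a = i then Inside i (\<delta> i q a) else if q \<in> F i then enter a else Dead)" for s a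
  define accepting where "accepting = {Inside i q | i q. q \<in> F i}"
  define states where "states = insert Initial (insert Dead (\<Union>i. Inside i ` Q i))"
  define alt where "alt i u \<longleftrightarrow> (\<exists>ss. alternating i u ss)" for i u
  have alt_iff: "alt i u \<longleftrightarrow> (\<exists>x y. u = x @ y \<and> x \<in> L i \<and> (y = [] \<or> alt (\<not> i) y))" for i u
    unfolding alt_def by (rule alternating_iff)
  have alt_tag: "u \<noteq> [] \<and> tag (hd u) = i" if "alt i u" for i u
    using that tag_hd_alternating unfolding alt_def by blast
  \<comment> \<open>The language still to be accepted from \<open>Inside i q\<close>: the end of the
    present syllable, then nothing or an alternating word that starts in the other factor.\<close>
  define rest where "rest i q w \<longleftrightarrow> (\<exists>x y. w = x @ y \<and> x \<in> lists {b \<in> B. tag b = i} \<and>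
    foldl (\<delta> i) q x \<in> F i \<and> (y = [] \<or> alt (\<not> i) y))" for i q w
  have rest_alt: "rest (tag a) (\<delta> (tag a) (q0 (tag a)) a) w \<longleftrightarrow> alt (tag a) (a # w)"
    if "a \<in> B" for a w
  proof
    assume "rest (tag a) (\<delta> (tag a) (q0 (tag a)) a) w"
    then obtain x y where "w = x @ y" "x \<in> lists {b \<in> B. tag b = tag a}"
      "foldl (\<delta> (tag a)) (\<delta> (tag a) (q0 (tag a)) a) x \<in> F (tag a)" "y = [] \<or> alt (\<not> tag a) y"
      unfolding rest_def by blast
    then show "alt (tag a) (a # w)"
      unfolding alt_iff[of "tag a"] L[of "tag a"] using that
      by (intro exI[of _ "a # x"] exI[of _ y]) auto
  next
    assume "alt (tag a) (a # w)"
    then obtain x y where xy: "a # w = x @ y" "x \<in> L (tag a)" "y = [] \<or> alt (\<not> tag a) y"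
      unfolding alt_iff[of "tag a"] by blast
    then obtain x' where "x = a # x'" using L_closed[of x "tag a"] by (cases x) auto
    with xy show "rest (tag a) (\<delta> (tag a) (q0 (tag a)) a) w"
      unfolding rest_def L[of "tag a"] by auto
  qed
  have "step Dead a = Dead" for a by (simp add: step_def)
  then have "foldl step Dead w = Dead" for w by (induction w) simp_all
  then have dead: "foldl step Dead w \<notin> accepting" for w by (simp add: accepting_def)
  have step_Inside: "step (Inside i q) a =
    (if tag a = i then Inside i (\<delta> i q a) else if q \<in> F i then enter a else Dead)" for i q a
    by (simp add: step_def)
  have run: "foldl step (Inside i q) w \<in> accepting \<longleftrightarrow> rest i q w" if "w \<in> lists B" for i q w
    using that
  proof (induction w arbitrary: i q rule: list.induct)
    case Nil
    then show ?case using alt_tag by (auto simp: accepting_def rest_def)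
  next
    case (Cons a w)
    then have a: "a \<in> B" and w: "w \<in> lists B" by auto
    show ?case
    proof (cases "tag a = i")
      case True
      have "rest i (\<delta> i q a) w \<longleftrightarrow> rest i q (a # w)"
      proof
        assume "rest i (\<delta> i q a) w"
        then obtain x y where "w = x @ y" "x \<in> lists {b \<in> B. tag b = i}"
          "foldl (\<delta> i) (\<delta> i q a) x \<in> F i" "y = [] \<or> alt (\<not> i) y"
          unfolding rest_def by blast
        then show "rest i q (a # w)" unfolding rest_def using a True
          by (intro exI[of _ "a # x"] exI[of _ y]) auto
      next
        assume "rest i q (a # w)"
        then obtain x y where xy: "a # w = x @ y" "x \<in> lists {b \<in> B. tag b = i}"
          "foldl (\<delta> i) q x \<in> F i" "y = [] \<or> alt (\<not> i) y"
          unfolding rest_def by blast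
        \<comment> \<open>With \<open>x\<close> empty, \<open>a\<close> would be the first letter of
          a syllable of the other factor, against its tag.\<close>
        moreover have "x \<noteq> []" using xy(1,4) alt_tag[of "\<not> i" y] True by auto
        ultimately show "rest i (\<delta> i q a) w" unfolding rest_def by (cases x) auto
      qed
      then show ?thesis using Cons.IH[OF w] True by (simp add: step_Inside)
    next
      case False
      have "rest i q (a # w) \<longleftrightarrow> q \<in> F i \<and> alt (\<not> i) (a # w)"
      proof
        assume "rest i q (a # w)"
        then obtain x y where xy: "a # w = x @ y" "x \<in> lists {b \<in> B. tag b = i}"
          "foldl (\<delta> i) q x \<in> F i" "y = [] \<or> alt (\<not> i) y"
          unfolding rest_def by blast
        moreover have "x = []" using xy(1,2) False by (cases x) auto
        ultimately show "q \<in> F i \<and> alt (\<not> i) (a # w)" by auto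
      next
        assume "q \<in> F i \<and> alt (\<not> i) (a # w)"
        then show "rest i q (a # w)" unfolding rest_def
          by (intro exI[of _ "[]"] exI[of _ "a # w"]) auto
      qed
      also have "(\<not> i) = tag a" using False by auto
      also note rest_alt[OF a, of w, symmetric]
      finally have "rest i q (a # w) \<longleftrightarrow>
        q \<in> F i \<and> rest (tag a) (\<delta> (tag a) (q0 (tag a)) a) w" .
      then show ?thesis
        using Cons.IH[OF w] False by (simp add: step_Inside enter_def dead)
    qed
  qed
  have "w \<in> alternating_words \<longleftrightarrow> w \<in> lists B \<and> foldl step Initial w \<in> accepting" for w
  proof (cases w)
    case Nil
    then show ?thesis
      using alternating_normal_form by (auto simp: alternating_words_def accepting_def)
  next
    case (Cons a v)
    have "L i \<subseteq> lists B" for i unfolding L by auto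
    then have "w \<in> alternating_words \<Longrightarrow> w \<in> lists B"
      using alternating_lists unfolding alternating_words_def by blast
    moreover have "foldl step Initial w \<in> accepting \<longleftrightarrow> alt (tag a) w" if "w \<in> lists B"
      using that run rest_alt Cons by (simp add: step_def enter_def)
    moreover have "w \<in> alternating_words \<longleftrightarrow> alt (tag a) w"
      using alt_tag[of _ w] Cons by (auto simp: alternating_words_def alt_def)
    ultimately show ?thesis by blast
  qed
  then have "alternating_words = {w \<in> lists B. foldl step Initial w \<in> accepting}" by blast
  moreover have "\<forall>s\<in>states. \<forall>a\<in>B. step s a \<in> states"
  proof (intro ballI)
    fix s a assume "s \<in> states" "a \<in> B"
    have "Inside i q \<in> states \<longleftrightarrow> q \<in> Q i" for i q by (auto simp: states_def)
    moreover have "Dead \<in> states" by (simp add: states_def)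
    ultimately show "step s a \<in> states"
      using \<open>s \<in> states\<close> closed[OF _ \<open>a \<in> B\<close>] Q(2) by (cases s) (simp_all add: step_def enter_def)
  qed
  moreover have "finite states" "Initial \<in> states"
    using Q(1) by (simp_all add: states_def)
  moreover have "accepting \<subseteq> states"
    using Q(3) unfolding states_def accepting_def by blast
  ultimately show ?thesis by (intro regular_languageI)
qed

text \<open>A push touches only the front of a sequence. Surjectivity onto the factors supplies a
  combing word for the new front entry, and the syllables behind it are kept.\<close>

lemma alternating_words_normal_form:
  assumes surj: "\<And>i. word_value Z ` L i = {m \<in> carrier Z. tag m = i}"
    and w: "w \<noteq> []" "set w \<subseteq> carrier Z"
  shows "\<exists>u\<in>alternating_words. normal_form u = normal_form w"
proof -
  have "\<exists>u i. alternating i u (normal_form w)"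
    using w
  proof (induction w)
    case (Cons x w)
    have x: "x \<in> carrier Z" using Cons.prems by simp
    have block: "\<exists>u\<in>L (tag y). word_value Z u = y" if "y \<in> carrier Z" for y
    proof -
      have "y \<in> word_value Z ` L (tag y)" using that unfolding surj by simp
      then show ?thesis by blast
    qed
    show ?case
    proof (cases "w = []")
      case True
      then show ?thesis using block[OF x] alternating.single by (force simp: normal_form_def)
    next
      case False
      then obtain u i where u: "alternating i u (normal_form w)" using Cons by auto
      obtain y ys where ys: "normal_form w = y # ys"
        using alternating_normal_form[OF u] by (cases "normal_form w") auto
      have y: "tag y = i" "y \<in> carrier Z" using alternating_normal_form[OF u] ys by auto
      have nf: "normal_form (x # w) = push x (y # ys)"
        using ys by (simp add: normal_form_def)
      show ?thesis
      proof (cases "tag x = tag y")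
        case True
        obtain v where v: "v \<in> L i" "word_value Z v = x \<odot> y"
          using block[of "x \<odot> y"] True x y by (auto simp: tagged_closed tag_smult)
        show ?thesis
        proof (cases "ys = []")
          case True
          then show ?thesis using alternating.single[OF v(1)] v(2) nf \<open>tag x = tag y\<close> by auto
        next
          case False
          then obtain u' where "alternating (\<not> i) u' ys"
            using u unfolding ys by (elim alternating_ConsE) auto
          then show ?thesis using alternating.Cons[OF v(1)] v(2) nf \<open>tag x = tag y\<close> by auto
        qed
      next
        case False
        obtain v where v: "v \<in> L (tag x)" "word_value Z v = x" using block[OF x] by blast
        have "(\<not> tag x) = i" using False y(1) by auto
        then show ?thesis using alternating.Cons[OF v(1), of u "normal_form w"] u v(2) nf ys False by auto
      qed
    qed
  qed simp
  then show ?thesis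
    using alternating_normal_form unfolding alternating_words_def by blast
qed

end

section \<open>Normal forms in a free product\<close>

lemma generated_cong_subset:
  assumes "sgp_relations A R"
  shows "generated_cong A R \<subseteq> nonempty_words A \<times> nonempty_words A"
proof -
  have "(u, v) \<in> generated_cong A R \<Longrightarrow> u \<in> nonempty_words A \<and> v \<in> nonempty_words A" for u v
    by (induction rule: generated_cong.induct)
      (use assms in \<open>auto simp: sgp_relations_def intro: nonempty_words_append\<close>)
  then show ?thesis by auto
qed

lemma equiv_generated_cong:
  assumes "sgp_relations A R"
  shows "equiv (nonempty_words A) (generated_cong A R)"
proof (rule equivI)
  show "generated_cong A R \<subseteq> nonempty_words A \<times> nonempty_words A"
    by (rule generated_cong_subset) fact
  show "refl_on (nonempty_words A) (generated_cong A R)"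
    using generated_cong_subset[OF assms] by (auto simp: refl_on_def intro: generated_cong.refl)
  show "Relation.sym (generated_cong A R)"
    by (auto intro: symI generated_cong.sym)
  show "Relation.trans (generated_cong A R)"
    by (auto intro: transI generated_cong.trans)
qed

lemma generated_cong_mono:
  assumes "(u, v) \<in> generated_cong A R" "A \<subseteq> A'" "R \<subseteq> R'"
  shows "(u, v) \<in> generated_cong A' R'"
proof -
  have "nonempty_words A \<subseteq> nonempty_words A'"
    using assms(2) by (auto simp: nonempty_words_def)
  with assms(1) show ?thesis
    by (induction rule: generated_cong.induct)
      (use assms(3) in \<open>blast intro: generated_cong.intros\<close>)+
qed

text \<open>Trades the isomorphism with a quotient for a homomorphism on words whose kernel is the
  generated congruence, so that congruence classes need not be handled again.\<close>

lemma presentation_map: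
  assumes "is_sgp S" and iso: "sgp_iso S (Sgp A R)" and rel: "sgp_relations A R"
  obtains q where "q ` nonempty_words A = carrier S"
    "\<And>u v. u \<in> nonempty_words A \<Longrightarrow> v \<in> nonempty_words A \<Longrightarrow> q (u @ v) = q u \<odot>\<^bsub>S\<^esub> q v"
    "\<And>u v. u \<in> nonempty_words A \<Longrightarrow> v \<in> nonempty_words A \<Longrightarrow>
      q u = q v \<longleftrightarrow> (u, v) \<in> generated_cong A R"
proof -
  interpret is_sgp S by fact
  let ?W = "nonempty_words A" and ?C = "generated_cong A R"
  note eq = equiv_generated_cong[OF rel]
  obtain f where f: "bij_betw f (carrier S) (?W // ?C)"
    and hom: "\<And>x y. x \<in> carrier S \<Longrightarrow> y \<in> carrier S \<Longrightarrow> f (x \<odot>\<^bsub>S\<^esub> y) = f x \<odot>\<^bsub>Sgp A R\<^esub> f y"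
    using iso by (auto simp: sgp_iso_def Sgp_def)
  define g where "g = inv_into (carrier S) f"
  have g: "bij_betw g (?W // ?C) (carrier S)"
    unfolding g_def using f by (rule bij_betw_inv_into)
  have fg: "f (g X) = X" if "X \<in> ?W // ?C" for X
    using f that unfolding g_def by (rule bij_betw_inv_into_right)
  have gf: "g (f x) = x" if "x \<in> carrier S" for x
    using f that unfolding g_def by (rule bij_betw_inv_into_left)
  have cls: "?C `` {u} \<in> ?W // ?C" if "u \<in> ?W" for u
    using that by (rule quotientI)
  define q where "q u = g (?C `` {u})" for u
  have q_carrier: "q u \<in> carrier S" if "u \<in> ?W" for u
    using g cls[OF that] unfolding q_def by (auto simp: bij_betw_def)
  \<comment> \<open>The union in \<open>Sgp\<close> collapses to one class: all products of
    representatives are congruent, and neither index set is empty.\<close>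
  have mult: "?C `` {u} \<odot>\<^bsub>Sgp A R\<^esub> ?C `` {v} = ?C `` {u @ v}" if uv: "u \<in> ?W" "v \<in> ?W" for u v
  proof -
    have "?C `` {u' @ v'} = ?C `` {u @ v}" if "u' \<in> ?C `` {u}" "v' \<in> ?C `` {v}" for u' v'
    proof -
      have C: "(u, u') \<in> ?C" "(v, v') \<in> ?C" using that by auto
      then have "u' \<in> ?W" using generated_cong_subset[OF rel] by blast
      then have "(u @ v, u' @ v) \<in> ?C" "(u' @ v, u' @ v') \<in> ?C"
        using C uv(2) by (auto intro: generated_cong.left generated_cong.right)
      then have "(u @ v, u' @ v') \<in> ?C" by (rule generated_cong.trans)
      then show ?thesis using equiv_class_eq[OF eq] by blast
    qed
    then have "(\<Union>u'\<in>?C `` {u}. \<Union>v'\<in>?C `` {v}. ?C `` {u' @ v'}) =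
        (\<Union>u'\<in>?C `` {u}. \<Union>v'\<in>?C `` {v}. ?C `` {u @ v})"
      by (intro SUP_cong HOL.refl)
    also have "\<dots> = ?C `` {u @ v}"
    proof -
      have "?C `` {u} \<noteq> {}" "?C `` {v} \<noteq> {}" using uv generated_cong.refl by blast+
      then show ?thesis by (simp only: UN_constant if_False)
    qed
    finally show ?thesis by (simp only: Sgp_def sgp.simps)
  qed
  show ?thesis
  proof
    have "q ` ?W = g ` (?W // ?C)" unfolding q_def by (auto simp: quotient_def)
    also have "\<dots> = carrier S" using g by (rule bij_betw_imp_surj_on)
    finally show "q ` ?W = carrier S" .
    show "q (u @ v) = q u \<odot>\<^bsub>S\<^esub> q v" if uv: "u \<in> ?W" "v \<in> ?W" for u v
    proof -
      have "f (q u \<odot>\<^bsub>S\<^esub> q v) = ?C `` {u @ v}"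
        using hom[OF uv[THEN q_carrier]] mult[OF uv] uv[THEN cls] by (simp add: q_def fg)
      then show ?thesis
        using gf[OF smult_closed[OF uv[THEN q_carrier]]] by (simp add: q_def)
    qed
    show "q u = q v \<longleftrightarrow> (u, v) \<in> ?C" if uv: "u \<in> ?W" "v \<in> ?W" for u v
    proof -
      have "q u = q v \<longleftrightarrow> ?C `` {u} = ?C `` {v}"
        using fg[OF cls[OF uv(1)]] fg[OF cls[OF uv(2)]] unfolding q_def by metis
      also have "\<dots> \<longleftrightarrow> (u, v) \<in> ?C" using eq uv by (rule eq_equiv_class_iff)
      finally show ?thesis .
    qed
  qed
qed

text \<open>The left operand as the value of a mixed product is an arbitrary default. The laws of
  \<open>tagged_sgp\<close> concern elements of equal tag, where the tag is
  \<open>isl\<close>.\<close>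

definition sum_sgp :: "'a sgp \<Rightarrow> 'b sgp \<Rightarrow> ('a + 'b) sgp" where
  "sum_sgp S T = \<lparr>carrier = carrier S <+> carrier T,
     smult = (\<lambda>x y. case x of
         Inl a \<Rightarrow> (case y of Inl b \<Rightarrow> Inl (a \<odot>\<^bsub>S\<^esub> b) | Inr _ \<Rightarrow> x)
       | Inr a \<Rightarrow> (case y of Inl _ \<Rightarrow> x | Inr b \<Rightarrow> Inr (a \<odot>\<^bsub>T\<^esub> b)))\<rparr>"

lemma sum_sgp_simps [simp]:
  "carrier (sum_sgp S T) = carrier S <+> carrier T"
  "Inl a \<odot>\<^bsub>sum_sgp S T\<^esub> Inl b = Inl (a \<odot>\<^bsub>S\<^esub> b)"
  "Inr c \<odot>\<^bsub>sum_sgp S T\<^esub> Inr d = Inr (c \<odot>\<^bsub>T\<^esub> d)"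
  by (auto simp: sum_sgp_def)

lemma tagged_sgp_sum:
  assumes "is_sgp S" "is_sgp T"
  shows "tagged_sgp (sum_sgp S T) isl"
proof -
  interpret S: is_sgp S by fact
  interpret T: is_sgp T by fact
  show ?thesis
    by unfold_locales
      (auto simp: S.smult_closed T.smult_closed S.smult_assoc T.smult_assoc)
qed

lemma word_value_sum:
  "u \<noteq> [] \<Longrightarrow> word_value (sum_sgp S T) (map Inl u) = Inl (word_value S u)"
  "v \<noteq> [] \<Longrightarrow> word_value (sum_sgp S T) (map Inr v) = Inr (word_value T v)"
proof -
  show "u \<noteq> [] \<Longrightarrow> word_value (sum_sgp S T) (map Inl u) = Inl (word_value S u)"
    by (induction u rule: list_nonempty_induct) (auto simp: word_value_Cons)
  show "v \<noteq> [] \<Longrightarrow> word_value (sum_sgp S T) (map Inr v) = Inr (word_value T v)"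
    by (induction v rule: list_nonempty_induct) (auto simp: word_value_Cons)
qed

lemma word_value_map_hom:
  assumes hom: "\<And>u v. u \<in> nonempty_words A \<Longrightarrow> v \<in> nonempty_words A \<Longrightarrow> q (u @ v) = q u \<odot>\<^bsub>S\<^esub> q v"
  shows "u \<in> nonempty_words A \<Longrightarrow> word_value S (map (\<lambda>x. q [x]) u) = q u"
proof (induction u)
  case (Cons x u)
  show ?case
  proof (cases "u = []")
    case False
    then have u: "u \<in> nonempty_words A" using Cons.prems by (simp add: nonempty_words_def)
    show ?thesis using Cons.IH[OF u] hom[OF _ u, of "[x]"] Cons.prems False
      by (simp add: word_value_Cons)
  qed simp
qed (simp add: nonempty_words_def)

text \<open>\<open>N\<close> is well defined on \<open>P\<close> because each defining relation
  lives in one factor, where the normal form is just the value, and because the normal form of a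
  product depends only on those of its arguments. From \<open>N (\<phi> x) = [x]\<close> follows
  injectivity of \<open>\<phi>\<close>; with the last clause it gives uniqueness of normal forms in
  \<open>P\<close>.\<close>

lemma free_product_normal_forms:
  fixes S1 :: "'a sgp" and S2 :: "'b sgp" and P :: "'c sgp"
  assumes S1: "is_sgp S1" and S2: "is_sgp S2" and P: "is_sgp P"
    and fp: "is_free_product A1 R1 S1 A2 R2 S2 P"
  obtains \<phi> :: "'a + 'b \<Rightarrow> 'c" and N :: "'c \<Rightarrow> ('a + 'b) list"
  where "\<phi> ` carrier (sum_sgp S1 S2) \<subseteq> carrier P"
    "\<And>x y. x \<in> carrier (sum_sgp S1 S2) \<Longrightarrow> y \<in> carrier (sum_sgp S1 S2) \<Longrightarrow> isl x = isl y \<Longrightarrow>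
       \<phi> (x \<odot>\<^bsub>sum_sgp S1 S2\<^esub> y) = \<phi> x \<odot>\<^bsub>P\<^esub> \<phi> y"
    "\<And>p. p \<in> carrier P \<Longrightarrow>
       \<exists>w\<in>nonempty_words (carrier (sum_sgp S1 S2)). p = word_value P (map \<phi> w)"
    "\<And>x. x \<in> carrier (sum_sgp S1 S2) \<Longrightarrow> N (\<phi> x) = [x]"
    "\<And>p q. p \<in> carrier P \<Longrightarrow> q \<in> carrier P \<Longrightarrow>
       N (p \<odot>\<^bsub>P\<^esub> q) = foldr (tagged_sgp.push (sum_sgp S1 S2) isl) (N p) (N q)"
proof -
  let ?Z = "sum_sgp S1 S2" and ?A = "A1 \<union> A2" and ?R = "R1 \<union> R2"
  interpret tagged_sgp ?Z isl using S1 S2 by (rule tagged_sgp_sum)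
  have disj: "A1 \<inter> A2 = {}" and rel: "sgp_relations A1 R1" "sgp_relations A2 R2"
    and iso: "sgp_iso S1 (Sgp A1 R1)" "sgp_iso S2 (Sgp A2 R2)" "sgp_iso P (Sgp ?A ?R)"
    using fp by (auto simp: is_free_product_def)
  have sub: "nonempty_words A1 \<subseteq> nonempty_words ?A" "nonempty_words A2 \<subseteq> nonempty_words ?A"
    by (auto simp: nonempty_words_def)
  have rel': "sgp_relations ?A ?R" using rel sub by (fastforce simp: sgp_relations_def)
  obtain q1 where q1: "q1 ` nonempty_words A1 = carrier S1"
    "\<And>u v. u \<in> nonempty_words A1 \<Longrightarrow> v \<in> nonempty_words A1 \<Longrightarrow> q1 (u @ v) = q1 u \<odot>\<^bsub>S1\<^esub> q1 v"
    "\<And>u v. u \<in> nonempty_words A1 \<Longrightarrow> v \<in> nonempty_words A1 \<Longrightarrow>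
      q1 u = q1 v \<longleftrightarrow> (u, v) \<in> generated_cong A1 R1"
    by (rule presentation_map[OF S1 iso(1) rel(1)]) (rule that)
  obtain q2 where q2: "q2 ` nonempty_words A2 = carrier S2"
    "\<And>u v. u \<in> nonempty_words A2 \<Longrightarrow> v \<in> nonempty_words A2 \<Longrightarrow> q2 (u @ v) = q2 u \<odot>\<^bsub>S2\<^esub> q2 v"
    "\<And>u v. u \<in> nonempty_words A2 \<Longrightarrow> v \<in> nonempty_words A2 \<Longrightarrow>
      q2 u = q2 v \<longleftrightarrow> (u, v) \<in> generated_cong A2 R2"
    by (rule presentation_map[OF S2 iso(2) rel(2)]) (rule that)
  obtain q where q: "q ` nonempty_words ?A = carrier P"
    "\<And>u v. u \<in> nonempty_words ?A \<Longrightarrow> v \<in> nonempty_words ?A \<Longrightarrow> q (u @ v) = q u \<odot>\<^bsub>P\<^esub> q v"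
    "\<And>u v. u \<in> nonempty_words ?A \<Longrightarrow> v \<in> nonempty_words ?A \<Longrightarrow>
      q u = q v \<longleftrightarrow> (u, v) \<in> generated_cong ?A ?R"
    by (rule presentation_map[OF P iso(3) rel']) (rule that)
  \<comment> \<open>A consequence of the relations of a factor also holds in \<open>P\<close>, so
    the value in \<open>P\<close> of a word over one factor depends only on its value in that
    factor.\<close>
  have q_factor: "q u = q v" if "u \<in> nonempty_words A1" "v \<in> nonempty_words A1" "q1 u = q1 v" for u v
  proof -
    have "(u, v) \<in> generated_cong A1 R1" using that q1(3) by blast
    then have "(u, v) \<in> generated_cong ?A ?R" by (rule generated_cong_mono) auto
    then show ?thesis using q(3)[of u v] that(1,2) sub(1) by blast
  qed
  have q_factor': "q u = q v" if "u \<in> nonempty_words A2" "v \<in> nonempty_words A2" "q2 u = q2 v" for u v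
  proof -
    have "(u, v) \<in> generated_cong A2 R2" using that q2(3) by blast
    then have "(u, v) \<in> generated_cong ?A ?R" by (rule generated_cong_mono) auto
    then show ?thesis using q(3)[of u v] that(1,2) sub(2) by blast
  qed
  define r1 where "r1 = inv_into (nonempty_words A1) q1"
  define r2 where "r2 = inv_into (nonempty_words A2) q2"
  have r1: "r1 s \<in> nonempty_words A1" "q1 (r1 s) = s" if "s \<in> carrier S1" for s
    using that q1(1) unfolding r1_def by (auto simp: inv_into_into f_inv_into_f)
  have r2: "r2 s \<in> nonempty_words A2" "q2 (r2 s) = s" if "s \<in> carrier S2" for s
    using that q2(1) unfolding r2_def by (auto simp: inv_into_into f_inv_into_f)
  \<comment> \<open>\<open>r1\<close> and \<open>r2\<close> pick representatives; by
    \<open>q_factor\<close> and \<open>q_factor'\<close> the choice is immaterial.\<close>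
  define \<phi> where "\<phi> = case_sum (\<lambda>s. q (r1 s)) (\<lambda>s. q (r2 s))"
  define letter where "letter x = (if x \<in> A1 then Inl (q1 [x]) else Inr (q2 [x]))" for x
  have letter_A2: "letter x = Inr (q2 [x])" if "x \<in> A2" for x
    using that disj by (auto simp: letter_def)
  have letter1: "map letter u = map Inl (map (\<lambda>x. q1 [x]) u)" if "u \<in> nonempty_words A1" for u
    using that by (auto simp: letter_def nonempty_words_def)
  have letter2: "map letter u = map Inr (map (\<lambda>x. q2 [x]) u)" if "u \<in> nonempty_words A2" for u
    using that by (auto simp: letter_A2 nonempty_words_def)
  have q1_letter: "q1 [x] \<in> carrier S1" if "x \<in> A1" for x
    using that q1(1) by (intro subsetD[OF equalityD1[OF q1(1)]] imageI) simp
  have q2_letter: "q2 [x] \<in> carrier S2" if "x \<in> A2" for x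
    using that q2(1) by (intro subsetD[OF equalityD1[OF q2(1)]] imageI) simp
  have letter_closed: "letter x \<in> carrier ?Z" if "x \<in> ?A" for x
    using that q1_letter q2_letter by (auto simp: letter_def)
  define norm where "norm u = normal_form (map letter u)" for u
  have letters_closed: "set (map letter u) \<subseteq> carrier ?Z" if "u \<in> nonempty_words ?A" for u
    using that letter_closed by (auto simp: nonempty_words_def)
  have norm_append: "norm (u @ v) = foldr push (norm u) (norm v)"
    if "u \<in> nonempty_words ?A" "v \<in> nonempty_words ?A" for u v
    using normal_form_append[OF letters_closed letters_closed, OF that] by (simp add: norm_def)
  have norm1: "norm u = [Inl (q1 u)]" if u: "u \<in> nonempty_words A1" for u
  proof -
    have "map letter u \<in> nonempty_words {m \<in> carrier ?Z. isl m = True}"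
      using u q1_letter by (auto simp: letter_def nonempty_words_def)
    then have "norm u = [word_value ?Z (map letter u)]"
      using foldr_push_factor[of "map letter u" True "[]"] by (simp add: norm_def normal_form_def)
    also have "\<dots> = [Inl (q1 u)]"
      using word_value_map_hom[of A1 q1 S1 u, OF q1(2) u] u word_value_sum(1)[of "map (\<lambda>x. q1 [x]) u" S1 S2]
      unfolding letter1[OF u] by (simp add: nonempty_words_def)
    finally show ?thesis .
  qed
  have norm2: "norm u = [Inr (q2 u)]" if u: "u \<in> nonempty_words A2" for u
  proof -
    have "map letter u \<in> nonempty_words {m \<in> carrier ?Z. isl m = False}"
      using u q2_letter by (auto simp: letter_A2 nonempty_words_def)
    then have "norm u = [word_value ?Z (map letter u)]"
      using foldr_push_factor[of "map letter u" False "[]"] by (simp add: norm_def normal_form_def)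
    also have "\<dots> = [Inr (q2 u)]"
      using word_value_map_hom[of A2 q2 S2 u, OF q2(2) u] u word_value_sum(2)[of "map (\<lambda>x. q2 [x]) u" S1 S2]
      unfolding letter2[OF u] by (simp add: nonempty_words_def)
    finally show ?thesis .
  qed
  have norm_cong: "(u, v) \<in> generated_cong ?A ?R \<Longrightarrow> norm u = norm v" for u v
  proof (induction rule: generated_cong.induct)
    case (base u v)
    then consider "(u, v) \<in> R1" | "(u, v) \<in> R2" by blast
    then show ?case
    proof cases
      case 1
      then have "u \<in> nonempty_words A1" "v \<in> nonempty_words A1"
        using rel(1) by (auto simp: sgp_relations_def)
      moreover have "(u, v) \<in> generated_cong A1 R1" using 1 by (rule generated_cong.base)
      ultimately show ?thesis using q1(3)[of u v] by (simp add: norm1)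
    next
      case 2
      then have "u \<in> nonempty_words A2" "v \<in> nonempty_words A2"
        using rel(2) by (auto simp: sgp_relations_def)
      moreover have "(u, v) \<in> generated_cong A2 R2" using 2 by (rule generated_cong.base)
      ultimately show ?thesis using q2(3)[of u v] by (simp add: norm2)
    qed
  next
    case (left u v w)
    then have "u \<in> nonempty_words ?A" "v \<in> nonempty_words ?A"
      using generated_cong_subset[OF rel'] by auto
    then show ?case using left by (simp add: norm_append)
  next
    case (right u v w)
    then have "u \<in> nonempty_words ?A" "v \<in> nonempty_words ?A"
      using generated_cong_subset[OF rel'] by auto
    then show ?case using right by (simp add: norm_append)
  qed simp_all
  \<comment> \<open>The representative is again arbitrary, by \<open>norm_cong\<close>.\<close>
  define N where "N p = norm (inv_into (nonempty_words ?A) q p)" for p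
  have N_q: "N (q u) = norm u" if "u \<in> nonempty_words ?A" for u
  proof -
    let ?u = "inv_into (nonempty_words ?A) q (q u)"
    have "?u \<in> nonempty_words ?A" "q ?u = q u"
      using that by (auto intro: inv_into_into f_inv_into_f)
    then have "(?u, u) \<in> generated_cong ?A ?R" using q(3) that by blast
    then show ?thesis unfolding N_def by (rule norm_cong)
  qed
  have q_letter: "\<phi> (letter x) = q [x]" if "x \<in> ?A" for x
  proof (cases "x \<in> A1")
    case True
    then have "q (r1 (q1 [x])) = q [x]"
      using r1[OF q1_letter[OF True]] by (intro q_factor) simp_all
    then show ?thesis using True by (simp add: \<phi>_def letter_def)
  next
    case False
    then have "x \<in> A2" using that by blast
    then have "q (r2 (q2 [x])) = q [x]"
      using r2[OF q2_letter[of x]] by (intro q_factor') simp_all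
    then show ?thesis using False by (simp add: \<phi>_def letter_def)
  qed
  show ?thesis
  proof (rule that[of \<phi> N])
    show "\<phi> ` carrier ?Z \<subseteq> carrier P"
    proof (intro image_subsetI)
      fix x assume "x \<in> carrier ?Z"
      then have "\<phi> x \<in> q ` nonempty_words ?A"
      proof (cases x)
        case (Inl s)
        then have "r1 s \<in> nonempty_words ?A" using \<open>x \<in> carrier ?Z\<close> r1(1) sub(1) by auto
        then show ?thesis by (simp add: Inl \<phi>_def)
      next
        case (Inr s)
        then have "r2 s \<in> nonempty_words ?A" using \<open>x \<in> carrier ?Z\<close> r2(1) sub(2) by auto
        then show ?thesis by (simp add: Inr \<phi>_def)
      qed
      then show "\<phi> x \<in> carrier P" by (simp only: q(1))
    qed
    show "\<phi> (x \<odot>\<^bsub>?Z\<^esub> y) = \<phi> x \<odot>\<^bsub>P\<^esub> \<phi> y"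
      if xy: "x \<in> carrier ?Z" "y \<in> carrier ?Z" "isl x = isl y" for x y
    proof (cases x)
      case (Inl s)
      then obtain t where y: "y = Inl t" using xy(3) by (cases y) auto
      have st: "s \<in> carrier S1" "t \<in> carrier S1" using xy Inl y by auto
      then have closed: "s \<odot>\<^bsub>S1\<^esub> t \<in> carrier S1" using is_sgp.smult_closed[OF S1] by blast
      have "q (r1 (s \<odot>\<^bsub>S1\<^esub> t)) = q (r1 s @ r1 t)"
        using closed st r1 q1(2)[of "r1 s" "r1 t"]
        by (intro q_factor) (auto intro: nonempty_words_append)
      also have "\<dots> = q (r1 s) \<odot>\<^bsub>P\<^esub> q (r1 t)"
        using st r1(1) sub(1) by (intro q(2)) auto
      finally show ?thesis by (simp add: Inl y \<phi>_def)
    next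
      case (Inr s)
      then obtain t where y: "y = Inr t" using xy(3) by (cases y) auto
      have st: "s \<in> carrier S2" "t \<in> carrier S2" using xy Inr y by auto
      then have closed: "s \<odot>\<^bsub>S2\<^esub> t \<in> carrier S2" using is_sgp.smult_closed[OF S2] by blast
      have "q (r2 (s \<odot>\<^bsub>S2\<^esub> t)) = q (r2 s @ r2 t)"
        using closed st r2 q2(2)[of "r2 s" "r2 t"]
        by (intro q_factor') (auto intro: nonempty_words_append)
      also have "\<dots> = q (r2 s) \<odot>\<^bsub>P\<^esub> q (r2 t)"
        using st r2(1) sub(2) by (intro q(2)) auto
      finally show ?thesis by (simp add: Inr y \<phi>_def)
    qed
    show "\<exists>w\<in>nonempty_words (carrier ?Z). p = word_value P (map \<phi> w)"
      if p: "p \<in> carrier P" for p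
    proof -
      obtain u where u: "u \<in> nonempty_words ?A" "p = q u"
        using p unfolding q(1)[symmetric] by blast
      have "map \<phi> (map letter u) = map (\<lambda>x. q [x]) u"
        using u(1) q_letter by (auto simp: nonempty_words_def)
      then have "p = word_value P (map \<phi> (map letter u))"
        using word_value_map_hom[of ?A q P u, OF q(2) u(1)] u(2) by (simp del: map_map)
      moreover have "map letter u \<in> nonempty_words (carrier ?Z)"
        using u(1) letter_closed by (auto simp: nonempty_words_def)
      ultimately show ?thesis by blast
    qed
    show "N (\<phi> x) = [x]" if "x \<in> carrier ?Z" for x
    proof (cases x)
      case (Inl s)
      then have "s \<in> carrier S1" using that by auto
      then show ?thesis using Inl N_q[of "r1 s"] norm1[of "r1 s"] r1[of s] sub(1)
        by (auto simp: \<phi>_def)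
    next
      case (Inr s)
      then have "s \<in> carrier S2" using that by auto
      then show ?thesis using Inr N_q[of "r2 s"] norm2[of "r2 s"] r2[of s] sub(2)
        by (auto simp: \<phi>_def)
    qed
    show "N (p \<odot>\<^bsub>P\<^esub> p') = foldr push (N p) (N p')" if p: "p \<in> carrier P" "p' \<in> carrier P" for p p'
    proof -
      obtain u v where uv: "u \<in> nonempty_words ?A" "p = q u" "v \<in> nonempty_words ?A" "p' = q v"
        using p unfolding q(1)[symmetric] by blast
      then have "N (p \<odot>\<^bsub>P\<^esub> p') = N (q (u @ v))" by (simp add: q(2))
      also have "\<dots> = norm (u @ v)"
        using uv by (intro N_q nonempty_words_append)
      finally show ?thesis using uv by (simp add: norm_append N_q)
    qed
  qed
qed

text \<open>Injectivity of \<open>f\<close> makes equality of values the same on both sides. The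
  empty word is kept out because its value is unspecified, so \<open>val\<close> says nothing about
  it.\<close>

lemma tables_map:
  assumes inj: "inj f" and R: "[] \<notin> R"
    and val: "\<And>u. u \<noteq> [] \<Longrightarrow> word_value T (map f u) = f (word_value S u)"
  shows "mult_table T (map f ` R) = map (map_marked f) ` mult_table S R"
    and "equality_table T (map f ` R) = map (map_marked f) ` equality_table S R"
proof -
  have map_word: "map (map_marked f) (mult_word u v w) = mult_word (map f u) (map f v) (map f w)"
    "map (map_marked f) (eq_word u w) = eq_word (map f u) (map f w)" for u v w
    by (simp_all add: rev_map)
  have val_eq: "word_value T (map f u) = word_value T (map f w) \<longleftrightarrow> word_value S u = word_value S w"
    if "u \<noteq> []" "w \<in> R" for u w
  proof -
    have "w \<noteq> []" using that(2) R by blast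
    with that(1) show ?thesis by (simp add: val inj_eq[OF inj])
  qed
  have app: "u @ v \<noteq> []" if "u \<in> R" for u v using that R by auto
  show "mult_table T (map f ` R) = map (map_marked f) ` mult_table S R"
  proof (intro subset_antisym subsetI)
    fix x assume "x \<in> mult_table T (map f ` R)"
    then obtain u v w where uvw: "u \<in> R" "v \<in> R" "w \<in> R"
      and x: "x = mult_word (map f u) (map f v) (map f w)"
      and eq: "word_value T (map f (u @ v)) = word_value T (map f w)"
      unfolding mult_table_def by auto
    have "mult_word u v w \<in> mult_table S R"
      using uvw eq val_eq[OF app[OF uvw(1)] uvw(3)] unfolding mult_table_def by blast
    then show "x \<in> map (map_marked f) ` mult_table S R"
      unfolding x map_word(1)[symmetric] by (rule imageI)
  next
    fix x assume "x \<in> map (map_marked f) ` mult_table S R"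
    then obtain u v w where uvw: "u \<in> R" "v \<in> R" "w \<in> R" "word_value S (u @ v) = word_value S w"
      and x: "x = mult_word (map f u) (map f v) (map f w)"
      unfolding mult_table_def map_word(1)[symmetric] by blast
    have "word_value T (map f u @ map f v) = word_value T (map f w)"
      using uvw val_eq[OF app[OF uvw(1)] uvw(3), of v] by simp
    with uvw show "x \<in> mult_table T (map f ` R)"
      unfolding mult_table_def x by blast
  qed
  show "equality_table T (map f ` R) = map (map_marked f) ` equality_table S R"
  proof (intro subset_antisym subsetI)
    fix x assume "x \<in> equality_table T (map f ` R)"
    then obtain u w where uw: "u \<in> R" "w \<in> R"
      and x: "x = eq_word (map f u) (map f w)"
      and eq: "word_value T (map f u) = word_value T (map f w)"
      unfolding equality_table_def by auto
    have "eq_word u w \<in> equality_table S R"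
      using uw eq val_eq[of u w] R unfolding equality_table_def by blast
    then show "x \<in> map (map_marked f) ` equality_table S R"
      unfolding x map_word(2)[symmetric] by (rule imageI)
  next
    fix x assume "x \<in> map (map_marked f) ` equality_table S R"
    then obtain u w where uw: "u \<in> R" "w \<in> R" "word_value S u = word_value S w"
      and x: "x = eq_word (map f u) (map f w)"
      unfolding equality_table_def map_word(2)[symmetric] by blast
    have "word_value T (map f u) = word_value T (map f w)"
      using uw val_eq[of u w] R by blast
    with uw show "x \<in> equality_table T (map f ` R)"
      unfolding equality_table_def x by blast
  qed
qed

section \<open>A combing of the free product by alternating words\<close>

theorem corollary2p6:
  fixes S1 :: "'a sgp" and S2 :: "'b sgp" and P :: "'c sgp"
    and A1 A2 :: "'x set" and R1 R2 :: "('x list \<times> 'x list) set"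
  assumes "is_sgp S1" and "is_sgp S2" and "is_sgp P"
    and "is_free_product A1 R1 S1 A2 R2 S2 P"
    and "sgp_regular S1" and "word_hyperbolic S1"
    and "sgp_regular S2" and "word_hyperbolic S2"
  shows "word_hyperbolic P"
proof -
  let ?Z = "sum_sgp S1 S2"
  interpret P: is_sgp P by fact
  obtain B1 L1 where 1: "finite B1" "generates B1 S1" "regular_combing S1 B1 L1"
    "context_free (mult_table S1 L1)"
    using assms(6) by (auto simp: word_hyperbolic_def)
  obtain B2 L2 where 2: "finite B2" "generates B2 S2" "regular_combing S2 B2 L2"
    "context_free (mult_table S2 L2)"
    using assms(8) by (auto simp: word_hyperbolic_def)
  have B: "B1 \<subseteq> carrier S1" "B2 \<subseteq> carrier S2"
    using 1(2) 2(2) by (simp_all add: generates_def)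
  have reg: "regular_language B1 L1" "regular_language B2 L2"
    and words: "L1 \<subseteq> nonempty_words B1" "L2 \<subseteq> nonempty_words B2"
    and onto: "word_value S1 ` L1 = carrier S1" "word_value S2 ` L2 = carrier S2"
    using 1(3) 2(3) by (simp_all add: regular_combing_def)
  have ne: "[] \<notin> L1" "[] \<notin> L2" using words by (auto simp: nonempty_words_def)
  \<comment> \<open>Both combings are moved into the disjoint union of the carriers;
    \<open>True\<close> means the first factor because the tag is \<open>isl\<close>.\<close>
  define L where "L i = (if i then map Inl ` L1 else map Inr ` L2)" for i
  have L_words: "L i \<subseteq> nonempty_words {m \<in> B1 <+> B2. isl m = i}" for i
    by (cases i) (auto simp: L_def nonempty_words_def dest!: subsetD[OF words(1)] subsetD[OF words(2)])
  interpret tagged_combing ?Z isl L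
  proof (intro tagged_combing.intro tagged_combing_axioms.intro tagged_sgp_sum assms)
    have "nonempty_words {m \<in> B1 <+> B2. isl m = i} \<subseteq> nonempty_words {m \<in> carrier ?Z. isl m = i}" for i
      using B by (auto simp: nonempty_words_def)
    then show "L i \<subseteq> nonempty_words {m \<in> carrier ?Z. isl m = i}" for i
      using L_words by blast
  qed
  obtain \<phi> :: "'a + 'b \<Rightarrow> 'c" and N :: "'c \<Rightarrow> ('a + 'b) list"
    where \<phi>: "\<phi> ` carrier ?Z \<subseteq> carrier P"
      "\<And>x y. x \<in> carrier ?Z \<Longrightarrow> y \<in> carrier ?Z \<Longrightarrow> isl x = isl y \<Longrightarrow> \<phi> (x \<odot>\<^bsub>?Z\<^esub> y) = \<phi> x \<odot>\<^bsub>P\<^esub> \<phi> y"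
      "\<And>p. p \<in> carrier P \<Longrightarrow> \<exists>w\<in>nonempty_words (carrier ?Z). p = word_value P (map \<phi> w)"
    and N: "\<And>x. x \<in> carrier ?Z \<Longrightarrow> N (\<phi> x) = [x]"
      "\<And>p q. p \<in> carrier P \<Longrightarrow> q \<in> carrier P \<Longrightarrow> N (p \<odot>\<^bsub>P\<^esub> q) = foldr push (N p) (N q)"
    by (rule free_product_normal_forms[OF assms(1-4)]) (rule that)
  have map_\<phi>: "map \<phi> w \<in> nonempty_words (carrier P)" if "w \<noteq> []" "set w \<subseteq> carrier ?Z" for w
  proof -
    have "set (map \<phi> w) \<subseteq> carrier P" using that(2) \<phi>(1) unfolding set_map by blast
    then show ?thesis using that(1) by (auto simp: nonempty_words_def)
  qed
  have N_value: "N (word_value P (map \<phi> w)) = normal_form w"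
    if "w \<noteq> []" "set w \<subseteq> carrier ?Z" for w
    using that
  proof (induction w rule: list_nonempty_induct)
    case (cons x w)
    then have "word_value P (map \<phi> w) \<in> carrier P" "\<phi> x \<in> carrier P"
      using P.word_value_closed[OF map_\<phi>] \<phi>(1) by auto
    then show ?case using cons by (simp add: word_value_Cons N normal_form_def)
  qed (use N in \<open>simp add: normal_form_def\<close>)
  \<comment> \<open>Merging the head does not change the value in \<open>P\<close>, as
    \<open>\<phi>\<close> is multiplicative within each factor and \<open>P\<close> is
    associative.\<close>
  have value_push: "word_value P (map \<phi> (push x ys)) = \<phi> x \<odot>\<^bsub>P\<^esub> word_value P (map \<phi> ys)"
    if x: "x \<in> carrier ?Z" and ys: "ys \<noteq> []" "set ys \<subseteq> carrier ?Z" for x ys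
  proof -
    obtain y zs where yz: "ys = y # zs" using ys(1) by (cases ys) auto
    have y: "y \<in> carrier ?Z" "\<phi> x \<in> carrier P" "\<phi> y \<in> carrier P"
      using x ys yz \<phi>(1) by auto
    show ?thesis
    proof (cases "isl x = isl y \<and> zs \<noteq> []")
      case True
      then have "word_value P (map \<phi> zs) \<in> carrier P"
        using ys yz by (intro P.word_value_closed map_\<phi>) auto
      then show ?thesis
        using True x y yz \<phi>(2)[of x y] by (simp add: word_value_Cons P.smult_assoc)
    next
      case False
      then show ?thesis using x y yz \<phi>(2)[of x y] by (auto simp: word_value_Cons)
    qed
  qed
  have value_normal_form: "word_value P (map \<phi> (normal_form w)) = word_value P (map \<phi> w)"
    if "w \<noteq> []" "set w \<subseteq> carrier ?Z" for w
    using that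
  proof (induction w rule: list_nonempty_induct)
    case (cons x w)
    have "normal_form w \<noteq> []" using \<open>w \<noteq> []\<close> by (cases w) (auto simp: normal_form_def)
    moreover have "normal_form (x # w) = push x (normal_form w)" by (simp add: normal_form_def)
    ultimately show ?case
      using cons value_push[of x "normal_form w"] normal_form_closed[of w]
      by (simp add: word_value_Cons)
  qed (simp add: normal_form_def)
  \<comment> \<open>Normal forms decide equality in \<open>P\<close>: \<open>N\<close> computes the
    normal form from the value, and normalising does not change the value.\<close>
  have value_eq: "word_value P (map \<phi> u) = word_value P (map \<phi> w) \<longleftrightarrow> normal_form u = normal_form w"
    if "u \<noteq> []" "set u \<subseteq> carrier ?Z" "w \<noteq> []" "set w \<subseteq> carrier ?Z" for u w
    using N_value[OF that(1,2)] N_value[OF that(3,4)]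
      value_normal_form[OF that(1,2)] value_normal_form[OF that(3,4)] by metis
  let ?A = "\<phi> ` (B1 <+> B2)" and ?R = "map \<phi> ` alternating_words"
  have alt: "u \<noteq> [] \<and> set u \<subseteq> carrier ?Z" if "u \<in> alternating_words" for u
    using that alternating_normal_form unfolding alternating_words_def by blast
  \<comment> \<open>Injectivity on letters is what carries the automaton for
    \<open>alternating_words\<close> over to the alphabet in \<open>P\<close>.\<close>
  have "inj_on \<phi> (carrier ?Z)"
    by (rule inj_on_inverseI[of _ "\<lambda>p. hd (N p)"]) (simp only: N(1) list.sel)
  moreover have B_closed: "B1 <+> B2 \<subseteq> carrier ?Z" using B by auto
  ultimately have inj: "inj_on \<phi> (B1 <+> B2)" by (rule inj_on_subset)
  have surj: "word_value ?Z ` L i = {m \<in> carrier ?Z. isl m = i}" for i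
  proof (cases i)
    case True
    have "word_value ?Z (map Inl u) = Inl (word_value S1 u)" if "u \<in> L1" for u
      using that ne(1) by (intro word_value_sum(1)) auto
    then have "word_value ?Z ` L i = (\<lambda>u. Inl (word_value S1 u)) ` L1"
      using True by (simp add: L_def image_image)
    also have "\<dots> = Inl ` carrier S1" using onto(1) by (simp add: image_image[symmetric])
    finally show ?thesis using True by auto
  next
    case False
    have "word_value ?Z (map Inr u) = Inr (word_value S2 u)" if "u \<in> L2" for u
      using that ne(2) by (intro word_value_sum(2)) auto
    then have "word_value ?Z ` L i = (\<lambda>u. Inr (word_value S2 u)) ` L2"
      using False by (simp add: L_def image_image)
    also have "\<dots> = Inr ` carrier S2" using onto(2) by (simp add: image_image[symmetric])
    finally show ?thesis using False by auto
  qed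
  have onto_P: "word_value P ` ?R = carrier P"
  proof (intro subset_antisym subsetI)
    fix p assume "p \<in> word_value P ` ?R"
    then show "p \<in> carrier P" using alt map_\<phi> P.word_value_closed by auto
  next
    fix p assume "p \<in> carrier P"
    then obtain w where w: "w \<noteq> []" "set w \<subseteq> carrier ?Z" "p = word_value P (map \<phi> w)"
      using \<phi>(3)[of p] by (auto simp: nonempty_words_def)
    obtain u where u: "u \<in> alternating_words" "normal_form u = normal_form w"
      using alternating_words_normal_form[OF surj w(1,2)] by blast
    then have "p = word_value P (map \<phi> u)" using value_eq[of u w] alt[OF u(1)] w by simp
    then show "p \<in> word_value P ` ?R" using u(1) by blast
  qed
  have "regular_language {b \<in> B1 <+> B2. isl b = i} (L i)" for i
  proof (cases i)
    case True
    have "{b \<in> B1 <+> B2. isl b = i} = Inl ` B1" using True by auto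
    then show ?thesis using True regular_language_map[OF reg(1), of Inl] by (simp add: L_def)
  next
    case False
    have "{b \<in> B1 <+> B2. isl b = i} = Inr ` B2" using False by auto
    then show ?thesis using False regular_language_map[OF reg(2), of Inr] by (simp add: L_def)
  qed
  then have reg_alt: "regular_language (B1 <+> B2) alternating_words"
    by (rule regular_alternating_words)
  then have alt_words: "alternating_words \<subseteq> nonempty_words (B1 <+> B2)"
    using alt unfolding regular_language_def nonempty_words_def by blast
  have R_words: "?R \<subseteq> nonempty_words ?A"
    using alt_words unfolding nonempty_words_def lists_image by blast
  have A_closed: "?A \<subseteq> carrier P" using \<phi>(1) image_mono[OF B_closed, of \<phi>] by blast
  have "regular_combing P ?A ?R"
    unfolding regular_combing_def
    using regular_language_map[OF reg_alt inj] R_words onto_P by simp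
  moreover have "generates ?A P"
    unfolding generates_def
  proof (intro conjI subset_antisym)
    have "nonempty_words ?A \<subseteq> nonempty_words (carrier P)"
      using A_closed by (auto simp: nonempty_words_def)
    then show "word_value P ` nonempty_words ?A \<subseteq> carrier P" using P.word_value_closed by blast
    show "carrier P \<subseteq> word_value P ` nonempty_words ?A" using onto_P R_words by blast
  qed (fact A_closed)
  moreover have "finite ?A" using 1(1) 2(1) by simp
  moreover have "context_free (mult_table P ?R)"
  proof -
    have map_word: "map (map_marked \<phi>) (mult_word u v w) = mult_word (map \<phi> u) (map \<phi> v) (map \<phi> w)"
      for u v w by (simp add: rev_map)
    have val: "word_value P (map \<phi> u @ map \<phi> v) = word_value P (map \<phi> w) \<longleftrightarrow>
        normal_form (u @ v) = normal_form w"
      if "u \<in> alternating_words" "v \<in> alternating_words" "w \<in> alternating_words" for u v w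
      using value_eq[of "u @ v" w] that[THEN alt] by simp
    \<comment> \<open>By \<open>value_eq\<close> the table of \<open>P\<close> is the letterwise
      image of a table described by normal forms alone, and a letter map preserves
      context-freeness.\<close>
    have "mult_table P ?R = map (map_marked \<phi>) ` free_table"
    proof (intro subset_antisym subsetI)
      fix x assume "x \<in> mult_table P ?R"
      then obtain u v w where uvw: "u \<in> alternating_words" "v \<in> alternating_words"
        "w \<in> alternating_words" and x: "x = mult_word (map \<phi> u) (map \<phi> v) (map \<phi> w)"
        and "word_value P (map \<phi> u @ map \<phi> v) = word_value P (map \<phi> w)"
        unfolding mult_table_def by blast
      then have "mult_word u v w \<in> free_table" using val unfolding free_table_def by blast
      then show "x \<in> map (map_marked \<phi>) ` free_table"
        unfolding x map_word[symmetric] by (rule imageI)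
    next
      fix x assume "x \<in> map (map_marked \<phi>) ` free_table"
      then obtain u v w where uvw: "u \<in> alternating_words" "v \<in> alternating_words"
        "w \<in> alternating_words" "normal_form (u @ v) = normal_form w"
        and x: "x = mult_word (map \<phi> u) (map \<phi> v) (map \<phi> w)"
        unfolding free_table_def map_word[symmetric] by blast
      then show "x \<in> mult_table P ?R" using val unfolding mult_table_def by blast
    qed
    moreover have "context_free free_table"
    proof (rule context_free_free_table)
      have eq: "context_free (equality_table S1 L1)" "context_free (equality_table S2 L2)"
        using assms 1 2 by (blast intro: context_free_equality_table)+
      note tables1 = tables_map[OF inj_Inl ne(1) word_value_sum(1)[of _ S1 S2]]
      note tables2 = tables_map[OF inj_Inr ne(2) word_value_sum(2)[of _ S1 S2]]
      show "context_free (mult_table ?Z (L i))" for i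
        using 1(4) 2(4) by (simp add: L_def tables1 tables2 context_free_map)
      show "context_free (equality_table ?Z (L i))" for i
        using eq by (simp add: L_def tables1 tables2 context_free_map)
    qed
    ultimately show ?thesis by (simp add: context_free_map)
  qed
  ultimately show ?thesis unfolding word_hyperbolic_def by blast
qed

end
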